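(* Let $\langle G\rightarrow S,\alpha\rightarrow A\rangle$ be an ordinary voltage graph embedding, and let $z\in Z(G)$ induce a nonseparating cycle $G[z]$ such that $G[z]^\alpha$ is a disjoint union of orientation-preserving cycles. Let $W=d_1\cdots d_k$ be an Eulerian walk of $G[z]$ based at $v\in V(G[z])$, let $w'$ be the vertex of the special claw corresponding to the edge of $d_1$ described in the context, and let $a\in A$. Then there are $$\frac{|A(v)|}{|A^{\veebar}(w',G[z])|}$$ z-regions of $S_v^a$ with respect to $\{z_v^b: b\in aA(v)\}$.
   Context: Graphs are finite connected multigraphs (loops and multiple edges allowed); a cycle is a connected 2-regular subgraph (a loop is a cycle). $S$ is a compact connected surface without boundary, and $G\rightarrow S$ denotes a cellular embedding. $D(G)$ is the set of darts (directed edges); a dart $d$ has tail $t(d)$, head $h(d)$ and opposite dart $d^{-1}$; each edge has one dart chosen as positive, also denoted $e$. A walk is a sequence of darts $d_1\cdots d_m$ with $h(d_i)=t(d_{i+1})$; it is closed if $h(d_m)=t(d_1)$. An ordinary voltage graph embedding $\langle G\rightarrow S,\alpha\rightarrow A\rangle$ consists of a cellular embedding $G\rightarrow S$, a finite group $A$, and a map $\alpha:D(G)\to A$ with $\alpha(d^{-1})=\alpha(d)^{-1}$. The net voltage of $W=d_1\cdots d_m$ is the product $\alpha(d_1)\cdots\alpha(d_m)$. The derived graph $G^\alpha$ has vertices $v^a$ and edges $e^a$ ($a\in A$), the directed edge $e^a$ going from $t(e)^a$ to $h(e)^{a\alpha(e)}$; $p$ is the projection $v^a\mapsto v$, $e^a\mapsto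 e$. The derived embedding $G^\alpha\rightarrow S^\alpha$ is obtained by gluing a 2-cell to each closed walk of $G^\alpha$ that is a lift of a facial boundary: if a face has boundary walk $W_f$ with net voltage of order $r$, there are $|A|/r$ faces over it, each bounded by a concatenation of $r$ successive lifts of $W_f$. $S^\alpha$ need not be connected; $S_v^a$ is the component containing $v^a$. The map $p$ extends to a (possibly branched) covering $S^\alpha\to S$. $A(v)$ is the group of net voltages of closed walks in $G$ based at $v$. $Z(G)$ is the cycle space of $G$ over $\mathbb{Z}_2$; for a 1-chain $z$, $G[z]$ is the subgraph induced by its edges. A cycle is orientation-preserving if a thin (ribbon) neighborhood of it is an annulus, and orientation-reversing if it is a Möbius band. A cycle $C$ of $G$ is separating if $S\setminus C$ is not connected and nonseparating otherwise. An Eulerian walk of a cycle is a closed walk traversing each of its edges exactly once. $G[z]^\alpha=p^{-1}(G[z])$ is a disjoint union of cycles; $G[z]_v^a$ is the component containing $v^a$, and $z_v^a$ is the 1-chain of $S^\alpha$ inducing it. The 1-chains over $z$ contained in $S_v^a$ are those in $\{z_v^b:b\in aA(v)\}$. Given a set $X$ of 1-chains inducing pairwise vertex-disjoint orientation-preserving cycles, the z-regions with respect to $X$ are the connected sub-2-complexes bounded by these cycles, i.e. those formed by the faces (with their subfaces) in a connected component of the surface minus the union of the cycles. Medial graph and special claw. A corner of $G\rightarrow S$ at a vertex $x$ is a component of (small disc neighborhood of $x$) minus the edges at $x$. The subdivision $G'$ of $G$ has a new vertex $v_e$ in the middle of each edge $e$. The medial graph $M$ has vertices $v_e$ ($e\in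 E(G)$) and, for each corner, one edge drawn across the corner joining the vertices $v_e,v_{e'}$ of the edges $e,e'$ bounding the corner. $M'$ is obtained from $M$ by subdividing each edge, adding one vertex per corner (placed in that corner). The total graph $T(G)$ is $G'\cup M'$. The extended voltage assignment: fix a preferred direction on each edge $e$; in $G'$ the dart from $t(e)$ to $v_e$ gets $\alpha(e)$ and the dart from $v_e$ to $h(e)$ gets $1_A$; in $M'$, for each of the two corners at the tail end of $e$ flanked by $e$, the dart from the subdividing vertex of that corner to $v_e$ gets $\alpha(e)$; inverse darts get inverse voltages, and all remaining darts get $1_A$. The special claw corresponding to an edge $e$ at its end at the vertex $v$ is the subgraph of $T(G)$ consisting of the three edges joining $v_e$ to $v$, $w'$, $y'$, where $w',y'$ are the vertices of $M'$ lying in the two corners at $v$ flanking that end of $e$. Here it is taken for the edge of $d_1$ at its end at $v=t(d_1)$. A walk $W'$ in $M'$ transversely crosses $G[z]$ if it contains a subwalk $d_id_{i+1}$ such that $d_i$ intersects one component of $U^*(h(d_i))\setminus G[z]$ and $d_{i+1}$ intersects the other, where $U^*(x)$ is a small disc neighborhood of $x$ meeting only $x$ and the ends of edges at $x$. $A'(w')$ is the group of net voltages of closed walks in $M'$ based at $w'$, and $A^{\veebar}(w',G[z])$ is the subgroup of $A'(w')$ consisting of net voltages of closed walks in $M'$ based at $w'$ that do not transversely cross $G[z]$. *)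

theory Defs
  imports
    Complex_Main
    "HOL-Library.Z2"
    "HOL-Algebra.Coset"
    "HOL-Combinatorics.Orbits"
    "Graph_Theory.Graph_Theory"
begin

section \<open>Cellular embeddings\<close>

text \<open>
  A multigraph is a finite bidirected digraph: its arcs are the darts, and the involution
  \<open>opp\<close> sends a dart to the opposite dart.  The two darts of a loop are distinct, with the same tail.

  A cellular embedding in a closed surface, orientable or not, is given by its rotation
  system with edge signatures.  Fix a local orientation at every vertex.  Then
  \<open>rot d\<close> is the dart that follows \<open>d\<close> counterclockwise around the tail of \<open>d\<close>, and
  \<open>twisted d\<close> states that the band of the edge of \<open>d\<close> joins the discs at its two ends in a way
  that reverses the chosen orientations.
\<close>

record ('v, 'd) embedding =
  skel :: "('v, 'd) pre_digraph"
  opp :: "'d \<Rightarrow> 'd"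
  rot :: "'d \<Rightarrow> 'd"
  twisted :: "'d \<Rightarrow> bool"

locale cellular_embedding =
  fin_digraph "skel M" + bidirected_digraph "skel M" "opp M"
  for M :: "('v, 'd) embedding" +
  assumes rot_permutes: "rot M permutes arcs (skel M)"
    and rot_cyclic: "v \<in> verts (skel M) \<Longrightarrow> out_arcs (skel M) v \<noteq> {} \<Longrightarrow>
      cyclic_on (rot M) (out_arcs (skel M) v)"
    and twisted_opp: "d \<in> arcs (skel M) \<Longrightarrow> twisted M (opp M d) = twisted M d"

definition edge :: "('v, 'd) embedding \<Rightarrow> 'd \<Rightarrow> 'd set" where
  "edge M d = {d, opp M d}"

definition edges :: "('v, 'd) embedding \<Rightarrow> 'd set set" where
  "edges M = edge M ` arcs (skel M)"

text \<open>
  A flag \<open>(d, s)\<close> is one side of the initial half of the dart \<open>d\<close>: the counterclockwise side as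
  seen from the tail of \<open>d\<close> if \<open>s\<close> is true, the clockwise side otherwise.  Every flag has exactly
  one other flag in the same corner (\<open>across_corner\<close>) and exactly one other flag on the
  same side of the same edge (\<open>along_edge\<close>).
\<close>

type_synonym 'd flag = "'d \<times> bool"

definition flags :: "('v, 'd) embedding \<Rightarrow> 'd flag set" where
  "flags M = arcs (skel M) \<times> UNIV"

fun across_corner :: "('v, 'd) embedding \<Rightarrow> 'd flag \<Rightarrow> 'd flag" where
  "across_corner M (d, s) = (if s then (rot M d, False) else (inv_into UNIV (rot M) d, True))"

fun along_edge :: "('v, 'd) embedding \<Rightarrow> 'd flag \<Rightarrow> 'd flag" where
  "along_edge M (d, s) = (opp M d, if twisted M d then s else \<not> s)"

definition corner :: "('v, 'd) embedding \<Rightarrow> 'd flag \<Rightarrow> 'd flag set" where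
  "corner M x = {x, across_corner M x}"

definition corners :: "('v, 'd) embedding \<Rightarrow> 'd flag set set" where
  "corners M = corner M ` flags M"

definition edge_side :: "('v, 'd) embedding \<Rightarrow> 'd flag \<Rightarrow> 'd flag set" where
  "edge_side M x = {x, along_edge M x}"

text \<open>
  The boundary polygon of a face alternates between sides of edges and corners, so that a face is
  given by the set of all flags on its boundary.
\<close>

definition face :: "('v, 'd) embedding \<Rightarrow> 'd flag \<Rightarrow> 'd flag set" where
  "face M x = {y. (x, y) \<in> {(p, q). p \<in> flags M \<and> q \<in> {along_edge M p, across_corner M p}}\<^sup>*}"

definition faces :: "('v, 'd) embedding \<Rightarrow> 'd flag set set" where
  "faces M = face M ` flags M"

definition next_flag :: "('v, 'd) embedding \<Rightarrow> 'd flag \<Rightarrow> 'd flag" where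
  "next_flag M x = across_corner M (along_edge M x)"

text \<open>
  The first \<open>n\<close> darts traversed when the boundary of a face is traced starting at the flag \<open>x\<close>.
  The trace closes up, giving a facial boundary walk, when \<open>(next_flag M ^^ n) x = x\<close>.
\<close>

definition facial_walk :: "('v, 'd) embedding \<Rightarrow> 'd flag \<Rightarrow> nat \<Rightarrow> 'd list" where
  "facial_walk M x n = map (\<lambda>i. fst ((next_flag M ^^ i) x)) [0..<n]"


section \<open>Cells, components and separating subgraphs\<close>

datatype ('v, 'd) cell = Vertex 'v | Edge "'d set" | Face "'d flag set"

definition cells :: "('v, 'd) embedding \<Rightarrow> ('v, 'd) cell set" where
  "cells M = Vertex ` verts (skel M) \<union> Edge ` edges M \<union> Face ` faces M"

fun subface :: "('v, 'd) embedding \<Rightarrow> ('v, 'd) cell \<Rightarrow> ('v, 'd) cell \<Rightarrow> bool" where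
  "subface M (Vertex v) (Edge e) \<longleftrightarrow> (\<exists>d\<in>e. tail (skel M) d = v)"
| "subface M (Vertex v) (Face f) \<longleftrightarrow> (\<exists>(d, s)\<in>f. tail (skel M) d = v)"
| "subface M (Edge e) (Face f) \<longleftrightarrow> (\<exists>(d, s)\<in>f. d \<in> e)"
| "subface M _ _ \<longleftrightarrow> False"

text \<open>
  A subset of a finite cell complex that is a union of open cells is connected if and only if any
  two of its cells are joined by a sequence of its cells in which consecutive ones are incident.
\<close>

definition component :: "('v, 'd) embedding \<Rightarrow> ('v, 'd) cell set \<Rightarrow> ('v, 'd) cell \<Rightarrow>
    ('v, 'd) cell set" where
  "component M U c = {c'. (c, c') \<in>
     {(p, q). p \<in> U \<and> q \<in> U \<and> (subface M p q \<or> subface M q p)}\<^sup>*}"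

definition components :: "('v, 'd) embedding \<Rightarrow> ('v, 'd) cell set \<Rightarrow> ('v, 'd) cell set set" where
  "components M U = component M U ` U"

definition subgraph_cells :: "('v, 'd) embedding \<Rightarrow> ('v, 'd) pre_digraph \<Rightarrow>
    ('v, 'd) cell set" where
  "subgraph_cells M H = Vertex ` verts H \<union> (Edge \<circ> edge M) ` arcs H"

definition separating :: "('v, 'd) embedding \<Rightarrow> ('v, 'd) pre_digraph \<Rightarrow> bool" where
  "separating M H \<longleftrightarrow> \<not> (\<forall>c \<in> cells M - subgraph_cells M H. \<forall>c' \<in> cells M - subgraph_cells M H.
     c' \<in> component M (cells M - subgraph_cells M H) c)"


section \<open>Chains and cycles\<close>

type_synonym 'd chain = "'d set \<Rightarrow> bit"

text \<open>The boundary of a loop is zero, since both of its darts leave the same vertex.\<close>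

definition cycle_space :: "('v, 'd) embedding \<Rightarrow> 'd chain set" where
  "cycle_space M = {z. (\<forall>e. e \<notin> edges M \<longrightarrow> z e = 0) \<and>
     (\<forall>v\<in>verts (skel M). (\<Sum>d\<in>out_arcs (skel M) v. z (edge M d)) = 0)}"

definition chain_graph :: "('v, 'd) embedding \<Rightarrow> 'd chain \<Rightarrow> ('v, 'd) pre_digraph" where
  "chain_graph M z =
     (let D = {d \<in> arcs (skel M). z (edge M d) = 1}
      in (skel M)\<lparr>verts := tail (skel M) ` D, arcs := D\<rparr>)"

definition graph_chain :: "('v, 'd) embedding \<Rightarrow> ('v, 'd) pre_digraph \<Rightarrow> 'd chain" where
  "graph_chain M H e = of_bool (e \<in> edge M ` arcs H)"

text \<open>The number of darts leaving a vertex is its degree, loops being counted twice.\<close>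

definition is_cycle :: "('v, 'd) pre_digraph \<Rightarrow> bool" where
  "is_cycle C \<longleftrightarrow> Digraph_Component.connected C \<and> (\<forall>v\<in>verts C. out_degree C v = 2)"

text \<open>
  A ribbon neighborhood of a cycle is a closed chain of vertex discs and edge bands.  It
  is an annulus if the number of twisted bands is even, and a Moebius band otherwise.
\<close>

definition orientation_preserving :: "('v, 'd) embedding \<Rightarrow> ('v, 'd) pre_digraph \<Rightarrow> bool" where
  "orientation_preserving M C \<longleftrightarrow> even (card (edge M ` {d \<in> arcs C. twisted M d}))"

definition graph_component :: "('v, 'd) pre_digraph \<Rightarrow> 'v \<Rightarrow> ('v, 'd) pre_digraph" where
  "graph_component H v = H \<restriction> {u. v \<rightarrow>\<^sup>*\<^bsub>H\<^esub> u}"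

definition eulerian_walk :: "('v, 'd) embedding \<Rightarrow> ('v, 'd) pre_digraph \<Rightarrow> 'v \<Rightarrow> 'd list \<Rightarrow> bool" where
  "eulerian_walk M C v W \<longleftrightarrow> pre_digraph.awalk C v W v \<and>
     distinct (map (edge M) W) \<and> set (map (edge M) W) = edge M ` arcs C"


section \<open>Voltages and the derived embedding\<close>

locale voltage_graph_embedding = cellular_embedding M + A: group A
  for M :: "('v, 'd) embedding" and A :: "('g, 'm) monoid_scheme" +
  fixes \<alpha> :: "'d \<Rightarrow> 'g"
  assumes connected_skel: "Digraph_Component.connected (skel M)"
    and finite_group: "finite (carrier A)"
    and voltage_closed: "d \<in> arcs (skel M) \<Longrightarrow> \<alpha> d \<in> carrier A"
    and voltage_opp: "d \<in> arcs (skel M) \<Longrightarrow> \<alpha> (opp M d) = inv\<^bsub>A\<^esub> (\<alpha> d)"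

definition net_voltage :: "('g, 'm) monoid_scheme \<Rightarrow> ('d \<Rightarrow> 'g) \<Rightarrow> 'd list \<Rightarrow> 'g" where
  "net_voltage A \<alpha> W = foldr (\<lambda>d g. \<alpha> d \<otimes>\<^bsub>A\<^esub> g) W \<one>\<^bsub>A\<^esub>"

definition local_group :: "('g, 'm) monoid_scheme \<Rightarrow> ('v, 'd) pre_digraph \<Rightarrow> ('d \<Rightarrow> 'g) \<Rightarrow> 'v \<Rightarrow>
    'g set" where
  "local_group A G \<alpha> v = {net_voltage A \<alpha> W | W. pre_digraph.awalk G v W v}"

text \<open>
  The derived dart \<open>(d, a)\<close> is the lift of \<open>d\<close> whose tail lies in layer \<open>a\<close>.
  Hence for a positive dart \<open>e\<close> the two darts of the derived edge \<open>e\<^sup>a\<close>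
  are \<open>(e, a)\<close> and \<open>(opp e, a \<otimes> \<alpha> e)\<close>.
\<close>

definition derived_graph :: "('v, 'd) pre_digraph \<Rightarrow> ('g, 'm) monoid_scheme \<Rightarrow> ('d \<Rightarrow> 'g) \<Rightarrow>
    ('v \<times> 'g, 'd \<times> 'g) pre_digraph" where
  "derived_graph G A \<alpha> =
     \<lparr>verts = verts G \<times> carrier A, arcs = arcs G \<times> carrier A,
      tail = (\<lambda>(d, a). (tail G d, a)), head = (\<lambda>(d, a). (head G d, a \<otimes>\<^bsub>A\<^esub> \<alpha> d))\<rparr>"

text \<open>
  The rotations and the signatures are lifted from the base embedding.  By the lemmas
  \<open>derived_facial_walk\<close> and \<open>derived_facial_walk_closes\<close> below, the facial boundary
  walks of the result are exactly the closed walks that are lifts of facial boundaries.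
\<close>

definition derived_embedding :: "('v, 'd) embedding \<Rightarrow> ('g, 'm) monoid_scheme \<Rightarrow> ('d \<Rightarrow> 'g) \<Rightarrow>
    ('v \<times> 'g, 'd \<times> 'g) embedding" where
  "derived_embedding M A \<alpha> =
     \<lparr>skel = derived_graph (skel M) A \<alpha>,
      opp = (\<lambda>(d, a). if d \<in> arcs (skel M) \<and> a \<in> carrier A
                      then (opp M d, a \<otimes>\<^bsub>A\<^esub> \<alpha> d) else (d, a)),
      rot = (\<lambda>(d, a). if a \<in> carrier A then (rot M d, a) else (d, a)),
      twisted = (\<lambda>(d, a). twisted M d)\<rparr>"

fun lift_walk :: "('g, 'm) monoid_scheme \<Rightarrow> ('d \<Rightarrow> 'g) \<Rightarrow> 'g \<Rightarrow> 'd list \<Rightarrow> ('d \<times> 'g) list" where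
  "lift_walk A \<alpha> a [] = []"
| "lift_walk A \<alpha> a (d # W) = (d, a) # lift_walk A \<alpha> (a \<otimes>\<^bsub>A\<^esub> \<alpha> d) W"

definition graph_preimage :: "('v, 'd) embedding \<Rightarrow> ('g, 'm) monoid_scheme \<Rightarrow> ('d \<Rightarrow> 'g) \<Rightarrow>
    ('v, 'd) pre_digraph \<Rightarrow> ('v \<times> 'g, 'd \<times> 'g) pre_digraph" where
  "graph_preimage M A \<alpha> H =
     (derived_graph (skel M) A \<alpha>)\<lparr>verts := verts H \<times> carrier A, arcs := arcs H \<times> carrier A\<rparr>"

definition lifted_chain :: "('v, 'd) embedding \<Rightarrow> ('g, 'm) monoid_scheme \<Rightarrow> ('d \<Rightarrow> 'g) \<Rightarrow>
    'd chain \<Rightarrow> 'v \<Rightarrow> 'g \<Rightarrow> ('d \<times> 'g) chain" where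
  "lifted_chain M A \<alpha> z v b =
     graph_chain (derived_embedding M A \<alpha>)
       (graph_component (graph_preimage M A \<alpha> (chain_graph M z)) (v, b))"

definition derived_component :: "('v, 'd) embedding \<Rightarrow> ('g, 'm) monoid_scheme \<Rightarrow> ('d \<Rightarrow> 'g) \<Rightarrow>
    'v \<Rightarrow> 'g \<Rightarrow> ('v \<times> 'g, 'd \<times> 'g) cell set" where
  "derived_component M A \<alpha> v a =
     component (derived_embedding M A \<alpha>) (cells (derived_embedding M A \<alpha>)) (Vertex (v, a))"

text \<open>
  The regions of a connected component \<open>T\<close> of the surface with respect to the chains in \<open>X\<close>:
  for each component of the complement of the cycles, the complex of its faces and their subfaces.
\<close>

definition face_complex :: "('v, 'd) embedding \<Rightarrow> ('v, 'd) cell set \<Rightarrow> ('v, 'd) cell set" where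
  "face_complex M K = {c \<in> cells M. \<exists>f. Face f \<in> K \<and> (c = Face f \<or> subface M c (Face f))}"

definition z_regions :: "('v, 'd) embedding \<Rightarrow> ('v, 'd) cell set \<Rightarrow> 'd chain set \<Rightarrow>
    ('v, 'd) cell set set" where
  "z_regions M T X =
     face_complex M ` components M (T - (\<Union>x\<in>X. subgraph_cells M (chain_graph M x)))"


section \<open>The total graph and the medial graph\<close>

datatype ('v, 'd) total_vertex =
  Original 'v | Midpoint "'d set" | Corner "'d flag set"

text \<open>
  Every edge of the total graph has exactly one end at a midpoint \<open>v_e\<close>.  \<open>Half d\<close>
  joins it to the tail of \<open>d\<close>; \<open>Joint (d, s)\<close> joins it to the vertex placed in the corner
  at the tail of \<open>d\<close> on side \<open>s\<close> of \<open>d\<close>.  A dart is an edge together with a direction, \<open>True\<close>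
  being the direction towards the midpoint.
\<close>

datatype 'd total_edge = Half 'd | Joint "'d flag"

fun edge_end :: "'d total_edge \<Rightarrow> 'd" where
  "edge_end (Half d) = d"
| "edge_end (Joint x) = fst x"

fun outer_vertex :: "('v, 'd) embedding \<Rightarrow> 'd total_edge \<Rightarrow> ('v, 'd) total_vertex" where
  "outer_vertex M (Half d) = Original (tail (skel M) d)"
| "outer_vertex M (Joint x) = Corner (corner M x)"

definition total_graph :: "('v, 'd) embedding \<Rightarrow>
    (('v, 'd) total_vertex, 'd total_edge \<times> bool) pre_digraph" where
  "total_graph M =
     \<lparr>verts = Original ` verts (skel M) \<union> Midpoint ` edges M \<union> Corner ` corners M,
      arcs = (Half ` arcs (skel M) \<union> Joint ` flags M) \<times> UNIV,
      tail = (\<lambda>(y, b). if b then outer_vertex M y else Midpoint (edge M (edge_end y))),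
      head = (\<lambda>(y, b). if b then Midpoint (edge M (edge_end y)) else outer_vertex M y)\<rparr>"

definition subdivided_medial_graph :: "('v, 'd) embedding \<Rightarrow>
    (('v, 'd) total_vertex, 'd total_edge \<times> bool) pre_digraph" where
  "subdivided_medial_graph M =
     (total_graph M)\<lparr>verts := Midpoint ` edges M \<union> Corner ` corners M,
                     arcs := Joint ` flags M \<times> UNIV\<rparr>"

text \<open>The three edges at the midpoint of the edge of \<open>d\<close> on the side of the tail of \<open>d\<close>.\<close>

definition special_claw :: "('v, 'd) embedding \<Rightarrow> 'd \<Rightarrow>
    (('v, 'd) total_vertex, 'd total_edge \<times> bool) pre_digraph" where
  "special_claw M d =
     (let K = {Half d, Joint (d, True), Joint (d, False)}
      in (total_graph M)\<lparr>verts := insert (Midpoint (edge M d)) (outer_vertex M ` K),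
                         arcs := K \<times> UNIV\<rparr>)"

text \<open>A choice of a preferred direction on every edge, as the set of preferred darts.\<close>

definition preferred_directions :: "('v, 'd) embedding \<Rightarrow> 'd set \<Rightarrow> bool" where
  "preferred_directions M P \<longleftrightarrow> P \<subseteq> arcs (skel M) \<and>
     (\<forall>d\<in>arcs (skel M). d \<in> P \<longleftrightarrow> opp M d \<notin> P)"

definition extended_voltage :: "('g, 'm) monoid_scheme \<Rightarrow> ('d \<Rightarrow> 'g) \<Rightarrow> 'd set \<Rightarrow>
    'd total_edge \<times> bool \<Rightarrow> 'g" where
  "extended_voltage A \<alpha> P = (\<lambda>(y, b).
     let g = (if edge_end y \<in> P then \<alpha> (edge_end y) else \<one>\<^bsub>A\<^esub>)
     in if b then g else inv\<^bsub>A\<^esub> g)"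

text \<open>
  At a corner vertex, or at a midpoint not on \<open>G[z]\<close>, a small disc is not cut by \<open>G[z]\<close>; at the
  midpoint of an edge of \<open>G[z]\<close> the two components of the cut disc are the two sides of that edge.
\<close>

definition transversely_crosses :: "('v, 'd) embedding \<Rightarrow> 'd chain \<Rightarrow>
    ('d total_edge \<times> bool) list \<Rightarrow> bool" where
  "transversely_crosses M z W \<longleftrightarrow>
     (\<exists>i x y. Suc i < length W \<and> W ! i = (Joint x, True) \<and> W ! Suc i = (Joint y, False) \<and>
        z (edge M (fst x)) = 1 \<and> edge_side M x \<noteq> edge_side M y)"

definition noncrossing_group :: "('v, 'd) embedding \<Rightarrow> ('g, 'm) monoid_scheme \<Rightarrow> ('d \<Rightarrow> 'g) \<Rightarrow>
    'd set \<Rightarrow> ('v, 'd) total_vertex \<Rightarrow> 'd chain \<Rightarrow> 'g set" where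
  "noncrossing_group M A \<alpha> P w z =
     {net_voltage A (extended_voltage A \<alpha> P) W | W.
        pre_digraph.awalk (subdivided_medial_graph M) w W w \<and> \<not> transversely_crosses M z W}"


section \<open>Facial walks of the derived embedding\<close>

lemma derived_simps [simp]:
  "skel (derived_embedding M A \<alpha>) = derived_graph (skel M) A \<alpha>"
  "verts (derived_graph G A \<alpha>) = verts G \<times> carrier A"
  "arcs (derived_graph G A \<alpha>) = arcs G \<times> carrier A"
  "tail (derived_graph G A \<alpha>) (d, a) = (tail G d, a)"
  "head (derived_graph G A \<alpha>) (d, a) = (head G d, a \<otimes>\<^bsub>A\<^esub> \<alpha> d)"
  "twisted (derived_embedding M A \<alpha>) (d, a) = twisted M d"
  by (simp_all add: derived_embedding_def derived_graph_def)

context voltage_graph_embedding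
begin

lemma derived_opp:
  "d \<in> arcs (skel M) \<Longrightarrow> a \<in> carrier A \<Longrightarrow>
    opp (derived_embedding M A \<alpha>) (d, a) = (opp M d, a \<otimes>\<^bsub>A\<^esub> \<alpha> d)"
  by (simp add: derived_embedding_def)

lemma derived_rot:
  "a \<in> carrier A \<Longrightarrow> rot (derived_embedding M A \<alpha>) (d, a) = (rot M d, a)"
  by (simp add: derived_embedding_def)

lemma derived_rot_permutes:
  "rot (derived_embedding M A \<alpha>) permutes (arcs (skel M) \<times> carrier A)"
proof (rule bij_imp_permutes)
  have r: "bij_betw (rot M) (arcs (skel M)) (arcs (skel M))"
    using rot_permutes by (rule permutes_imp_bij)
  have "bij_betw (map_prod (rot M) id) (arcs (skel M) \<times> carrier A) (arcs (skel M) \<times> carrier A)"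
    by (rule bij_betw_map_prod[OF r]) simp
  moreover have "\<And>x. x \<in> arcs (skel M) \<times> carrier A \<Longrightarrow>
      map_prod (rot M) id x = rot (derived_embedding M A \<alpha>) x"
    by (auto simp: derived_rot)
  ultimately show "bij_betw (rot (derived_embedding M A \<alpha>))
      (arcs (skel M) \<times> carrier A) (arcs (skel M) \<times> carrier A)"
    using bij_betw_cong by blast
  show "rot (derived_embedding M A \<alpha>) x = x" if "x \<notin> arcs (skel M) \<times> carrier A" for x
    using that permutes_not_in[OF rot_permutes]
    by (cases x) (auto simp: derived_embedding_def)
qed

lemma derived_cellular: "cellular_embedding (derived_embedding M A \<alpha>)"
proof -
  let ?D = "derived_embedding M A \<alpha>"
  have fin: "fin_digraph (skel ?D)"
    by unfold_locales (auto simp: finite_group voltage_closed)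
  have bi: "bidirected_digraph (skel ?D) (opp ?D)"
  proof (rule wf_digraph.bidirected_digraphI)
    show "wf_digraph (skel ?D)"
      using fin by (simp add: fin_digraph_def)
    show "opp ?D x = x" if "x \<notin> arcs (skel ?D)" for x
      using that by (cases x) (auto simp: derived_embedding_def)
    show "opp ?D x \<noteq> x" if "x \<in> arcs (skel ?D)" for x
      using that arev_neq by (cases x) (auto simp: derived_opp)
    show "opp ?D (opp ?D x) = x" if "x \<in> arcs (skel ?D)" for x
      using that
      by (cases x) (auto simp: derived_opp voltage_closed voltage_opp A.m_assoc)
    show "tail (skel ?D) (opp ?D x) = head (skel ?D) x" if "x \<in> arcs (skel ?D)" for x
      using that by (cases x) (auto simp: derived_opp)
  qed
  have cyc: "cyclic_on (rot ?D) (out_arcs (skel ?D) u)"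
    if u: "u \<in> verts (skel ?D)" and ne: "out_arcs (skel ?D) u \<noteq> {}" for u
  proof -
    obtain v a where ua: "u = (v, a)" "v \<in> verts (skel M)" "a \<in> carrier A"
      using u by auto
    have out: "out_arcs (skel ?D) u = (\<lambda>d. (d, a)) ` out_arcs (skel M) v"
      using ua by (auto simp: out_arcs_def)
    have "cyclic_on (rot M) (out_arcs (skel M) v)"
      using ne ua(2) out by (metis image_empty out rot_cyclic)
    then obtain s where s: "s \<in> out_arcs (skel M) v" "out_arcs (skel M) v = orbit (rot M) s"
      by (auto simp: cyclic_on_def)
    have pw: "(rot ?D ^^ n) (d, a) = ((rot M ^^ n) d, a)" for n d
      by (induction n) (auto simp: derived_rot ua(3))
    have "orbit (rot ?D) (s, a) = (\<lambda>d. (d, a)) ` orbit (rot M) s"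
      by (auto simp: orbit_altdef pw)
    then show ?thesis
      unfolding cyclic_on_def out using s by auto
  qed
  show ?thesis
    unfolding cellular_embedding_def cellular_embedding_axioms_def
    using fin bi cyc derived_rot_permutes twisted_opp
    by (auto simp: derived_opp)
qed

lemma derived_next_flag:
  assumes "d \<in> arcs (skel M)" "a \<in> carrier A"
  shows "next_flag (derived_embedding M A \<alpha>) ((d, a), s) =
    ((fst (next_flag M (d, s)), a \<otimes>\<^bsub>A\<^esub> \<alpha> d), snd (next_flag M (d, s)))"
proof -
  let ?D = "derived_embedding M A \<alpha>"
  have c: "a \<otimes>\<^bsub>A\<^esub> \<alpha> d \<in> carrier A"
    using assms voltage_closed by simp
  have "inv_into UNIV (rot ?D) (x, b) = (inv_into UNIV (rot M) x, b)"
    if b: "b \<in> carrier A" for x b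
  proof -
    have "rot M (inv_into UNIV (rot M) x) = x"
      using permutes_surj[OF rot_permutes] by (simp add: surj_f_inv_f)
    then have "rot ?D (inv_into UNIV (rot M) x, b) = (x, b)"
      by (simp add: derived_rot b)
    then show ?thesis
      using permutes_inj[OF derived_rot_permutes] by (metis inv_f_eq)
  qed
  then show ?thesis
    using c assms by (auto simp: next_flag_def derived_opp derived_rot)
qed

lemma next_flag_closed:
  assumes "x \<in> flags M"
  shows "(next_flag M ^^ n) x \<in> flags M"
proof -
  have "next_flag M y \<in> flags M" if "y \<in> flags M" for y
    using that permutes_in_image[OF rot_permutes] permutes_in_image[OF permutes_inv[OF rot_permutes]]
    by (cases y) (auto simp: next_flag_def flags_def)
  then show ?thesis
    using assms by (induction n) auto
qed

lemma net_voltage_facial_walk_closed: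
  "x \<in> flags M \<Longrightarrow> net_voltage A \<alpha> (facial_walk M x n) \<in> carrier A"
proof -
  assume x: "x \<in> flags M"
  have "set W \<subseteq> arcs (skel M) \<Longrightarrow> net_voltage A \<alpha> W \<in> carrier A" for W
    by (induction W) (auto simp: net_voltage_def voltage_closed)
  moreover have "set (facial_walk M x n) \<subseteq> arcs (skel M)"
    using next_flag_closed[OF x] by (force simp: facial_walk_def flags_def mem_Times_iff)
  ultimately show ?thesis .
qed

lemma facial_walk_Suc: "facial_walk N x (Suc n) = fst x # facial_walk N (next_flag N x) n"
  unfolding facial_walk_def
  by (simp add: upt_conv_Cons map_Suc_upt[symmetric] funpow_swap1 del: upt_Suc)

theorem derived_facial_walk:
  assumes "(d, s) \<in> flags M" "a \<in> carrier A"
  shows "facial_walk (derived_embedding M A \<alpha>) ((d, a), s) n =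
    lift_walk A \<alpha> a (facial_walk M (d, s) n)"
  using assms
proof (induction n arbitrary: d s a)
  case 0
  then show ?case by (simp add: facial_walk_def)
next
  case (Suc n)
  obtain d' s' where n: "next_flag M (d, s) = (d', s')" by fastforce
  have "(d', s') \<in> flags M"
    using next_flag_closed[OF Suc.prems(1), of 1] n by simp
  moreover have d: "d \<in> arcs (skel M)"
    using Suc.prems(1) by (simp add: flags_def)
  ultimately show ?case
    using Suc.IH[of d' s' "a \<otimes>\<^bsub>A\<^esub> \<alpha> d"] Suc.prems(2) n voltage_closed
    by (simp add: facial_walk_Suc derived_next_flag)
qed

theorem derived_facial_walk_closes:
  assumes "(d, s) \<in> flags M" "a \<in> carrier A"
  shows "(next_flag (derived_embedding M A \<alpha>) ^^ n) ((d, a), s) = ((d, a), s) \<longleftrightarrow>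
    (next_flag M ^^ n) (d, s) = (d, s) \<and> net_voltage A \<alpha> (facial_walk M (d, s) n) = \<one>\<^bsub>A\<^esub>"
proof -
  have *: "(next_flag (derived_embedding M A \<alpha>) ^^ n) ((d, a), s) =
      ((fst ((next_flag M ^^ n) (d, s)), a \<otimes>\<^bsub>A\<^esub> net_voltage A \<alpha> (facial_walk M (d, s) n)),
       snd ((next_flag M ^^ n) (d, s)))"
    using assms
  proof (induction n arbitrary: d s a)
    case 0
    then show ?case by (simp add: facial_walk_def net_voltage_def)
  next
    case (Suc n)
    obtain d' s' where n: "next_flag M (d, s) = (d', s')" by fastforce
    have f: "(d', s') \<in> flags M"
      using next_flag_closed[OF Suc.prems(1), of 1] n by simp
    have d: "d \<in> arcs (skel M)"
      using Suc.prems(1) by (simp add: flags_def)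
    have "net_voltage A \<alpha> (facial_walk M (d, s) (Suc n)) =
        \<alpha> d \<otimes>\<^bsub>A\<^esub> net_voltage A \<alpha> (facial_walk M (d', s') n)"
      by (simp add: facial_walk_Suc n net_voltage_def)
    then show ?case
      using Suc.IH[OF f, of "a \<otimes>\<^bsub>A\<^esub> \<alpha> d"] Suc.prems(2) n d voltage_closed
        net_voltage_facial_walk_closed[OF f]
      by (simp add: funpow_swap1 derived_next_flag A.m_assoc del: funpow.simps add: funpow_Suc_right)
  qed
  show ?thesis
    using assms(2) net_voltage_facial_walk_closed[OF assms(1), of n]
    unfolding * by (auto simp: prod_eq_iff)
qed

end

end

theory Submission
  imports Defs
begin

text \<open>
  The theorem is an index count in a voltage graph whose vertices are the flags of the base
  embedding.  Think of a flag as a point inside a face, next to one side of a half-edge.  From a flag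
  one can walk along its edge, across its corner, or through its edge to the other side.  Only
  a step along the edge of a dart \<open>d\<close> traverses a dart, and it contributes the voltage \<open>\<alpha> d\<close>; the
  flags of the derived embedding are the pairs of a flag and a group element, and their steps
  are the lifts of the steps below (\<open>flag_step_lift_iff\<close>).

  Cutting a surface along a subgraph forbids the steps through the edges of that subgraph.  Incident cells
  share a flag, and the flags of a cell that survives the cut are joined by permitted steps.
  Hence the components of the cut surface correspond to the classes of flags under permitted
  steps (\<open>region_of_eq_iff\<close>, \<open>z_regions_conv\<close>).

  Fix a flag \<open>x\<close> at \<open>v\<close> in the corner \<open>w'\<close>.  Let \<open>H\<close> be the group of net voltages of closed walks of flags
  at \<open>x\<close>, and let \<open>L\<close> be the subgroup coming from the walks that never pass through \<open>G[z]\<close>.  The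
  complement of \<open>G[z]\<close> is connected, so every flag of the component \<open>S_v^a\<close> is joined, without crossing
  a lift of \<open>G[z]\<close>, to a lift of \<open>x\<close> in some layer \<open>a h\<close> with \<open>h\<close> in \<open>H\<close>; and the layers
  \<open>a h\<close> and \<open>a h'\<close> give the same region exactly if \<open>h L = h' L\<close>.  So there are
  \<open>|H| / |L|\<close> regions (\<open>card_regions\<close>).

  It remains to recognize the two groups.  A walk of flags shadows a walk of \<open>G\<close> at the tails of
  its darts, and all flags at one vertex are joined by steps of trivial voltage, so that \<open>H\<close> is
  \<open>A(v)\<close> (\<open>local_group_conv\<close>).  A walk in the subdivided medial graph moves from corner to corner through the
  midpoints of edges; a passage that avoids a transverse crossing
  does what steps along or through an edge do, with the same voltage, so that \<open>L\<close> is the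
  group of the walks that do not transversely cross \<open>G[z]\<close> (\<open>noncrossing_group_conv\<close>).
\<close>

section \<open>Connectivity of flags\<close>

text \<open>
  The darts in \<open>Q\<close> are those of the edges along which the surface is cut: a step may pass from one
  side of an edge to the other only outside \<open>Q\<close>.
\<close>

definition flag_step :: "('v, 'd) embedding \<Rightarrow> 'd set \<Rightarrow> ('d flag \<times> 'd flag) set" where
  "flag_step N Q = {(x, y). x \<in> flags N \<and>
     (y = along_edge N x \<or> y = across_corner N x \<or> y = (fst x, \<not> snd x) \<and> fst x \<notin> Q)}"

abbreviation flag_conn :: "('v, 'd) embedding \<Rightarrow> 'd set \<Rightarrow> ('d flag \<times> 'd flag) set" where
  "flag_conn N Q \<equiv> (flag_step N Q)\<^sup>*"

definition cut_cells :: "('v, 'd) embedding \<Rightarrow> 'd set \<Rightarrow> ('v, 'd) cell set" where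
  "cut_cells N Q = Vertex ` tail (skel N) ` Q \<union> Edge ` edge N ` Q"

text \<open>
  Two incident cells always share a flag, so that flags can stand in for cells in every
  question about connectivity.
\<close>

fun cell_flags :: "('v, 'd) embedding \<Rightarrow> ('v, 'd) cell \<Rightarrow> 'd flag set" where
  "cell_flags N (Vertex u) = {x \<in> flags N. tail (skel N) (fst x) = u}"
| "cell_flags N (Edge e) = {x. fst x \<in> e}"
| "cell_flags N (Face f) = f"

abbreviation adjacent_cells :: "('v, 'd) embedding \<Rightarrow> ('v, 'd) cell set \<Rightarrow>
    (('v, 'd) cell \<times> ('v, 'd) cell) set" where
  "adjacent_cells N U \<equiv> {(p, q). p \<in> U \<and> q \<in> U \<and> (subface N p q \<or> subface N q p)}"

definition region_of :: "('v, 'd) embedding \<Rightarrow> 'd set \<Rightarrow> 'd flag \<Rightarrow> ('v, 'd) cell set" where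
  "region_of N Q x = face_complex N (component N (cells N - cut_cells N Q) (Face (face N x)))"

lemma component_sym: "c' \<in> component N U c \<Longrightarrow> c \<in> component N U c'"
proof -
  have "sym (adjacent_cells N U)" by (auto simp: sym_def)
  then have "sym ((adjacent_cells N U)\<^sup>*)" by (rule sym_rtrancl)
  then show "c' \<in> component N U c \<Longrightarrow> c \<in> component N U c'"
    unfolding component_def by (auto dest: symD)
qed

lemma component_trans: "c' \<in> component N U c \<Longrightarrow> c'' \<in> component N U c' \<Longrightarrow> c'' \<in> component N U c"
  unfolding component_def by (auto intro: rtrancl_trans)

lemma component_eq: "c' \<in> component N U c \<Longrightarrow> component N U c' = component N U c"
  using component_sym component_trans by (metis (no_types, opaque_lifting) subset_antisym subsetI)

lemma component_refl: "c \<in> component N U c"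
  unfolding component_def by auto

lemma component_subset:
  assumes "c \<in> U"
  shows "component N U c \<subseteq> U"
proof
  fix c' assume "c' \<in> component N U c"
  then have "(c, c') \<in> (adjacent_cells N U)\<^sup>*" by (simp add: component_def)
  then show "c' \<in> U" using assms by (cases rule: rtranclE) auto
qed

lemma component_adjacent:
  "p \<in> component N U c \<Longrightarrow> p \<in> U \<Longrightarrow> q \<in> U \<Longrightarrow> subface N p q \<or> subface N q p \<Longrightarrow>
    q \<in> component N U c"
  unfolding component_def by (auto intro: rtrancl_into_rtrancl)

text \<open>
  A component of the whole surface is closed under incidence, so no path of cells that starts inside
  it is lost when the other components are discarded.
\<close>

lemma component_Int:
  assumes "c \<in> component N (cells N) c0" "c \<in> U" "U \<subseteq> cells N"
  shows "component N (component N (cells N) c0 \<inter> U) c = component N U c"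
proof -
  let ?T = "component N (cells N) c0"
  have "(c, c') \<in> (adjacent_cells N (?T \<inter> U))\<^sup>* \<and> c' \<in> ?T" if "(c, c') \<in> (adjacent_cells N U)\<^sup>*" for c'
    using that
  proof (induction rule: rtrancl_induct)
    case base
    then show ?case using assms by auto
  next
    case (step p q)
    then have "q \<in> ?T"
      using component_adjacent[of p N "cells N" c0 q] assms(3) by blast
    then have "(p, q) \<in> adjacent_cells N (?T \<inter> U)" using step by auto
    then show ?case using step \<open>q \<in> ?T\<close> by (meson rtrancl.rtrancl_into_rtrancl)
  qed
  moreover have "(adjacent_cells N (?T \<inter> U))\<^sup>* \<subseteq> (adjacent_cells N U)\<^sup>*"
    by (rule rtrancl_mono) auto
  ultimately show ?thesis unfolding component_def by blast
qed

context cellular_embedding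
begin

lemma rot_in_arcs: "d \<in> arcs (skel M) \<Longrightarrow> rot M d \<in> arcs (skel M)"
  using permutes_in_image[OF rot_permutes] by blast

lemma rot_inv: "rot M (inv_into UNIV (rot M) d) = d"
  using permutes_surj[OF rot_permutes] by (simp add: surj_f_inv_f)

lemma inv_rot: "inv_into UNIV (rot M) (rot M d) = d"
  using permutes_inj[OF rot_permutes] by (simp add: inv_f_f)

lemma inv_rot_in_arcs: "d \<in> arcs (skel M) \<Longrightarrow> inv_into UNIV (rot M) d \<in> arcs (skel M)"
  using permutes_in_image[OF rot_permutes, of "inv_into UNIV (rot M) d"] by (simp add: rot_inv)

lemma tail_rot:
  assumes "d \<in> arcs (skel M)"
  shows "tail (skel M) (rot M d) = tail (skel M) d"
proof -
  have d: "d \<in> out_arcs (skel M) (tail (skel M) d)" "tail (skel M) d \<in> verts (skel M)"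
    using assms tail_in_verts by auto
  then have "cyclic_on (rot M) (out_arcs (skel M) (tail (skel M) d))"
    by (intro rot_cyclic) auto
  then show ?thesis using d cyclic_on_inI by fastforce
qed

lemma tail_inv_rot:
  "d \<in> arcs (skel M) \<Longrightarrow> tail (skel M) (inv_into UNIV (rot M) d) = tail (skel M) d"
  using tail_rot[OF inv_rot_in_arcs] by (simp add: rot_inv)

lemma along_along: "x \<in> flags M \<Longrightarrow> along_edge M (along_edge M x) = x"
  by (cases x) (auto simp: flags_def twisted_opp)

lemma across_across: "across_corner M (across_corner M x) = x"
  by (cases x) (auto simp: rot_inv inv_rot)

lemma along_flags: "x \<in> flags M \<Longrightarrow> along_edge M x \<in> flags M"
  by (cases x) (auto simp: flags_def)

lemma across_flags: "x \<in> flags M \<Longrightarrow> across_corner M x \<in> flags M"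
  by (cases x) (auto simp: flags_def rot_in_arcs inv_rot_in_arcs)

lemma tail_across:
  "x \<in> flags M \<Longrightarrow> tail (skel M) (fst (across_corner M x)) = tail (skel M) (fst x)"
  by (cases x) (auto simp: flags_def tail_rot tail_inv_rot)

lemma flag_step_flags: "(x, y) \<in> flag_step M Q \<Longrightarrow> x \<in> flags M \<and> y \<in> flags M"
  unfolding flag_step_def using along_flags across_flags by (auto simp: flags_def)

lemma flag_conn_flags: "(x, y) \<in> flag_conn M Q \<Longrightarrow> x \<in> flags M \<longleftrightarrow> y \<in> flags M"
  by (induction rule: rtrancl_induct) (auto dest: flag_step_flags)

lemma flag_step_sym: "sym (flag_step M Q)"
proof (rule symI)
  fix x y assume xy: "(x, y) \<in> flag_step M Q"
  then have "x \<in> flags M" "y \<in> flags M" using flag_step_flags by auto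
  then show "(y, x) \<in> flag_step M Q"
    using xy along_along[of x] across_across[of x] unfolding flag_step_def
    by (auto simp del: along_edge.simps across_corner.simps)
qed

lemma flag_conn_sym: "(x, y) \<in> flag_conn M Q \<Longrightarrow> (y, x) \<in> flag_conn M Q"
  using sym_rtrancl[OF flag_step_sym] by (auto dest: symD)

text \<open>
  If no edge may be crossed, exactly the two moves that trace the boundary of a face are left.
\<close>

lemma face_conv: "face M x = {y. (x, y) \<in> flag_conn M (arcs (skel M))}"
proof -
  have "{(p, q). p \<in> flags M \<and> q \<in> {along_edge M p, across_corner M p}} =
      flag_step M (arcs (skel M))"
    by (auto simp: flag_step_def flags_def)
  then show ?thesis by (simp add: face_def)
qed

lemma flag_conn_mono: "Q \<subseteq> Q' \<Longrightarrow> flag_conn M Q' \<subseteq> flag_conn M Q"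
  by (rule rtrancl_mono) (auto simp: flag_step_def)

lemma face_eq_iff: "face M x = face M y \<longleftrightarrow> (x, y) \<in> flag_conn M (arcs (skel M))"
proof
  assume "face M x = face M y"
  then have "y \<in> face M x" by (simp add: face_conv)
  then show "(x, y) \<in> flag_conn M (arcs (skel M))" by (simp add: face_conv)
next
  assume "(x, y) \<in> flag_conn M (arcs (skel M))"
  then show "face M x = face M y"
    unfolding face_conv using flag_conn_sym by (blast intro: rtrancl_trans)
qed

lemma self_in_face: "x \<in> face M x"
  by (simp add: face_conv)

lemma face_of_mem: "y \<in> face M x \<Longrightarrow> face M y = face M x"
  unfolding face_eq_iff by (simp add: face_conv flag_conn_sym)

lemma face_flags: "x \<in> flags M \<Longrightarrow> face M x \<subseteq> flags M"
  by (auto simp: face_conv dest: flag_conn_flags)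

lemma cell_flags_subset: "c \<in> cells M \<Longrightarrow> cell_flags M c \<subseteq> flags M"
proof (cases c)
  case (Face f)
  then show "c \<in> cells M \<Longrightarrow> ?thesis" using face_flags by (auto simp: cells_def faces_def)
qed (auto simp: cells_def edges_def edge_def flags_def)

lemma Face_in_cells: "x \<in> flags M \<Longrightarrow> Face (face M x) \<in> cells M"
  by (auto simp: cells_def faces_def)

lemma subface_shared_flag:
  assumes "subface M c c'" "c \<in> cells M" "c' \<in> cells M"
  shows "\<exists>x. x \<in> cell_flags M c \<and> x \<in> cell_flags M c'"
proof (cases c)
  case (Vertex u)
  show ?thesis
  proof (cases c')
    case (Edge e)
    then obtain d where "d \<in> e" "tail (skel M) d = u" using assms Vertex by auto
    moreover have "(d, True) \<in> cell_flags M c'" using Edge \<open>d \<in> e\<close> by simp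
    moreover then have "(d, True) \<in> flags M" using cell_flags_subset assms by blast
    ultimately show ?thesis using Vertex by (intro exI[of _ "(d, True)"]) simp
  next
    case (Face f)
    then obtain d s where ds: "(d, s) \<in> f" "tail (skel M) d = u" using assms Vertex by auto
    moreover then have "(d, s) \<in> flags M" using cell_flags_subset assms Face by force
    ultimately show ?thesis using Vertex Face by (intro exI[of _ "(d, s)"]) simp
  qed (use assms Vertex in auto)
next
  case (Edge e)
  then show ?thesis using assms by (cases c') auto
qed (use assms in auto)

lemma adjacent_shared_flag:
  assumes "(p, q) \<in> adjacent_cells M U" "U \<subseteq> cells M"
  shows "\<exists>x. x \<in> cell_flags M p \<and> x \<in> cell_flags M q"
proof -
  have "p \<in> cells M" "q \<in> cells M" "subface M p q \<or> subface M q p" using assms by auto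
  then show ?thesis using subface_shared_flag by meson
qed

lemma face_incident:
  assumes "c \<in> cells M" "x \<in> cell_flags M c"
  shows "c = Face (face M x) \<or> subface M c (Face (face M x))"
proof (cases c)
  case (Vertex u)
  then show ?thesis using assms self_in_face[of x] by (cases x) auto
next
  case (Edge e)
  then show ?thesis using assms self_in_face[of x] by (cases x) auto
next
  case (Face f)
  then obtain y where "f = face M y" using assms by (auto simp: cells_def faces_def)
  then show ?thesis using assms Face face_of_mem by auto
qed

text \<open>
  At a vertex that is not on the cut, one can turn all the way around: the rotation is
  cyclic on the darts at the vertex, and stepping across a corner and then through the
  next edge realizes it.
\<close>

lemma vertex_flags_conn:
  assumes "x \<in> flags M" "y \<in> flags M" "tail (skel M) (fst x) = tail (skel M) (fst y)"
    and "tail (skel M) (fst x) \<notin> tail (skel M) ` Q"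
  shows "(x, y) \<in> flag_conn M Q"
proof -
  define u where "u = tail (skel M) (fst x)"
  have out: "fst x \<in> out_arcs (skel M) u" "fst y \<in> out_arcs (skel M) u"
    using assms by (auto simp: u_def flags_def)
  have "u \<in> verts (skel M)" using out tail_in_verts by auto
  then have "cyclic_on (rot M) (out_arcs (skel M) u)" using out rot_cyclic by blast
  then have orb: "out_arcs (skel M) u = orbit (rot M) (fst x)"
    using out cyclic_on_alldef by metis
  have nQ: "d \<notin> Q" if "d \<in> out_arcs (skel M) u" for d
    using that assms(4) by (metis image_eqI in_out_arcs_conv u_def)
  have flip: "((d, s), (d, s')) \<in> flag_conn M Q" if "d \<in> out_arcs (skel M) u" for d s s'
  proof (cases "s = s'")
    case False
    then show ?thesis using that nQ[OF that]
      by (intro r_into_rtrancl) (auto simp: flag_step_def flags_def)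
  qed simp
  have turn: "((d, True), (rot M d, False)) \<in> flag_conn M Q" if "d \<in> out_arcs (skel M) u" for d
    using that by (intro r_into_rtrancl) (auto simp: flag_step_def flags_def)
  have "((fst x, True), (d, True)) \<in> flag_conn M Q" if "d \<in> orbit (rot M) (fst x)" for d
    using that
  proof (induction rule: orbit.induct)
    case base
    show ?case
      using turn[OF out(1)] flip[of "rot M (fst x)" False True] orb orbit.base[of "rot M" "fst x"]
      by (metis rtrancl_trans)
  next
    case (step d)
    then show ?case
      using turn[of d] flip[of "rot M d" False True] orb orbit.step[of d "rot M" "fst x"]
      by (metis rtrancl_trans)
  qed
  then have "((fst x, True), (fst y, True)) \<in> flag_conn M Q" using out orb by auto
  moreover have "(x, (fst x, True)) \<in> flag_conn M Q" using flip[OF out(1)] by (metis prod.collapse)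
  moreover have "((fst y, True), y) \<in> flag_conn M Q" using flip[OF out(2)] by (metis prod.collapse)
  ultimately show ?thesis by (meson rtrancl_trans)
qed

lemma edge_flags_conn:
  assumes "x \<in> flags M" "fst y \<in> edge M (fst x)" "fst x \<notin> Q" "opp M (fst x) \<notin> Q"
  shows "(x, y) \<in> flag_conn M Q"
proof -
  have flip: "((d, s), (d, s')) \<in> flag_conn M Q" if "d \<in> arcs (skel M)" "d \<notin> Q" for d s s'
  proof (cases "s = s'")
    case False
    then show ?thesis using that
      by (intro r_into_rtrancl) (auto simp: flag_step_def flags_def)
  qed simp
  have "(x, along_edge M x) \<in> flag_conn M Q"
    using assms by (intro r_into_rtrancl) (auto simp: flag_step_def)
  moreover have "fst (along_edge M x) = opp M (fst x)" by (cases x) simp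
  moreover have arcs: "fst x \<in> arcs (skel M)" "opp M (fst x) \<in> arcs (skel M)"
    using assms by (auto simp: flags_def)
  ultimately have "fst y = opp M (fst x) \<Longrightarrow> ?thesis"
    using flip[OF arcs(2) assms(4)] by (metis prod.collapse rtrancl_trans)
  moreover have "fst y = fst x \<Longrightarrow> ?thesis"
    using flip[OF arcs(1) assms(3)] by (metis prod.collapse)
  ultimately show ?thesis using assms(2) by (auto simp: edge_def)
qed

lemma cell_flags_conn:
  assumes Q: "Q \<subseteq> arcs (skel M)" "\<And>d. d \<in> Q \<Longrightarrow> opp M d \<in> Q"
    and c: "c \<in> cells M" "c \<notin> cut_cells M Q" "x \<in> cell_flags M c" "y \<in> cell_flags M c"
  shows "(x, y) \<in> flag_conn M Q"
proof (cases c)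
  case (Vertex u)
  then show ?thesis using c by (intro vertex_flags_conn) (auto simp: cut_cells_def)
next
  case (Edge e)
  then obtain d where d: "d \<in> arcs (skel M)" "e = edge M d"
    using c by (auto simp: cells_def edges_def)
  have x: "x \<in> flags M" using cell_flags_subset c by blast
  have e: "e = edge M (fst x)" using d c(3) Edge by (auto simp: edge_def)
  have nQ: "fst x \<notin> Q" using c(2) Edge e by (auto simp: cut_cells_def)
  moreover have "opp M (fst x) \<notin> Q" using nQ Q(2)[of "opp M (fst x)"] by auto
  ultimately show ?thesis using x e c(4) Edge by (intro edge_flags_conn) auto
next
  case (Face f)
  then obtain w where "f = face M w" using c by (auto simp: cells_def faces_def)
  then have "face M x = f" "face M y = f"
    using c(3,4) Face face_of_mem by auto
  then have "(x, y) \<in> flag_conn M (arcs (skel M))"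
    using face_eq_iff[of x y] by simp
  then show ?thesis using flag_conn_mono[OF Q(1)] by blast
qed

text \<open>
  A path of cells in the cut surface is followed by flags, changing over at a flag shared by
  two consecutive cells.
\<close>

lemma component_flags_conn:
  assumes Q: "Q \<subseteq> arcs (skel M)" "\<And>d. d \<in> Q \<Longrightarrow> opp M d \<in> Q"
    and "c \<in> cells M - cut_cells M Q" "c' \<in> component M (cells M - cut_cells M Q) c"
    and "x \<in> cell_flags M c" "y \<in> cell_flags M c'"
  shows "(x, y) \<in> flag_conn M Q"
proof -
  let ?U = "cells M - cut_cells M Q"
  have "(c, c') \<in> (adjacent_cells M ?U)\<^sup>*" using assms by (simp add: component_def)
  then have "\<forall>y\<in>cell_flags M c'. (x, y) \<in> flag_conn M Q"
  proof (induction rule: rtrancl_induct)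
    case base
    then show ?case using cell_flags_conn[OF Q] assms by blast
  next
    case (step p q)
    obtain w where w: "w \<in> cell_flags M p" "w \<in> cell_flags M q"
      using adjacent_shared_flag[OF step.hyps(2)] by blast
    have "q \<in> cells M" "q \<notin> cut_cells M Q" using step.hyps(2) by auto
    then show ?case
      using step.IH w cell_flags_conn[OF Q, of q w] by (meson rtrancl_trans)
  qed
  then show ?thesis using assms by blast
qed

text \<open>
  Conversely, a step of flags either stays in its face or passes through an edge that is
  not cut and incident with both faces.
\<close>

lemma conn_component:
  assumes Q: "Q \<subseteq> arcs (skel M)" "\<And>d. d \<in> Q \<Longrightarrow> opp M d \<in> Q"
    and "(x, y) \<in> flag_conn M Q" "x \<in> flags M"
  shows "Face (face M y) \<in> component M (cells M - cut_cells M Q) (Face (face M x))"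
  using assms(3)
proof (induction rule: rtrancl_induct)
  case base
  then show ?case by (rule component_refl)
next
  case (step y w)
  let ?U = "cells M - cut_cells M Q"
  have fl: "y \<in> flags M" "w \<in> flags M" using step flag_step_flags by blast+
  have FU: "Face (face M u) \<in> ?U" if "u \<in> flags M" for u
    using Face_in_cells[OF that] by (auto simp: cut_cells_def)
  show ?case
  proof (cases "w = (fst y, \<not> snd y) \<and> fst y \<notin> Q")
    case False
    then have "(y, w) \<in> flag_step M (arcs (skel M))" using step by (auto simp: flag_step_def)
    then have "face M y = face M w" unfolding face_eq_iff by blast
    then show ?thesis using step by simp
  next
    case True
    let ?e = "Edge (edge M (fst y))"
    have "fst y \<in> arcs (skel M)" using fl by (auto simp: flags_def)
    moreover have "opp M (fst y) \<notin> Q" using True Q(2)[of "opp M (fst y)"] by auto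
    ultimately have "?e \<in> ?U"
      using True by (auto simp: cells_def edges_def cut_cells_def edge_def doubleton_eq_iff)
    moreover have "subface M ?e (Face (face M y))"
      using face_incident[of ?e y] calculation by (simp add: edge_def)
    moreover have "subface M ?e (Face (face M w))"
      using face_incident[of ?e w] calculation True by (simp add: edge_def)
    ultimately show ?thesis
      using component_adjacent step.IH FU fl by metis
  qed
qed

lemma Face_in_face_complex: "Face f \<in> face_complex M K \<longleftrightarrow> Face f \<in> K \<inter> cells M"
  by (auto simp: face_complex_def)

text \<open>
  Faces are never removed by a cut, so a region still determines the component of the cut surface
  from which it was formed.
\<close>

lemma region_of_eq_iff:
  assumes Q: "Q \<subseteq> arcs (skel M)" "\<And>d. d \<in> Q \<Longrightarrow> opp M d \<in> Q"
    and fl: "x \<in> flags M" "y \<in> flags M"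
  shows "region_of M Q x = region_of M Q y \<longleftrightarrow> (x, y) \<in> flag_conn M Q"
proof
  let ?U = "cells M - cut_cells M Q"
  assume "region_of M Q x = region_of M Q y"
  moreover have "Face (face M y) \<in> region_of M Q y"
    unfolding region_of_def Face_in_face_complex
    using Face_in_cells fl component_refl by blast
  ultimately have "Face (face M y) \<in> component M ?U (Face (face M x))"
    unfolding region_of_def by (metis Face_in_face_complex IntE)
  moreover have "Face (face M x) \<in> ?U" using Face_in_cells[OF fl(1)] by (auto simp: cut_cells_def)
  ultimately show "(x, y) \<in> flag_conn M Q"
    using component_flags_conn[OF Q, of "Face (face M x)" "Face (face M y)" x y]
    by (simp add: self_in_face)
next
  assume "(x, y) \<in> flag_conn M Q"
  from conn_component[OF Q this fl(1)] show "region_of M Q x = region_of M Q y"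
    unfolding region_of_def using component_eq by metis
qed

lemma cut_cells_empty: "cut_cells M {} = {}"
  by (simp add: cut_cells_def)

lemma component_cells_flags:
  assumes "c0 \<in> cells M" "x0 \<in> cell_flags M c0" "c \<in> component M (cells M) c0"
  shows "cell_flags M c \<noteq> {}" "\<And>x. x \<in> cell_flags M c \<Longrightarrow> (x0, x) \<in> flag_conn M {}"
proof -
  have "(c0, c) \<in> (adjacent_cells M (cells M))\<^sup>*" using assms(3) by (simp add: component_def)
  then show "cell_flags M c \<noteq> {}"
  proof (cases rule: rtranclE)
    case base
    then show ?thesis using assms by auto
  next
    case (step p)
    then show ?thesis using adjacent_shared_flag[OF step(2)] by blast
  qed
  show "(x0, x) \<in> flag_conn M {}" if "x \<in> cell_flags M c" for x
    using component_flags_conn[of "{}" c0 c x0 x] assms that by (simp add: cut_cells_empty)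
qed

lemma conn_component_cells:
  assumes "c0 \<in> cells M" "x0 \<in> cell_flags M c0" "(x0, x) \<in> flag_conn M {}"
    "c \<in> cells M" "x \<in> cell_flags M c"
  shows "c \<in> component M (cells M) c0"
proof -
  have x0: "x0 \<in> flags M" using assms cell_flags_subset by blast
  have x: "x \<in> flags M" using assms cell_flags_subset by blast
  have *: "Face (face M w) \<in> component M (cells M) c"
    if "c \<in> cells M" "w \<in> cell_flags M c" "w \<in> flags M" for c w
    using face_incident[OF that(1,2)] that component_refl[of c M "cells M"]
      component_adjacent Face_in_cells by metis
  have "Face (face M x) \<in> component M (cells M) (Face (face M x0))"
    using conn_component[of "{}" x0 x] assms x0 by (simp add: cut_cells_empty)
  moreover have "Face (face M x0) \<in> component M (cells M) c0"
    using * assms x0 by blast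
  moreover have "Face (face M x) \<in> component M (cells M) c" using * assms x by blast
  ultimately show ?thesis using component_trans component_sym by metis
qed

lemma arc_cells:
  assumes "e \<in> arcs (skel M)" "U = cells M"
  shows "Vertex (tail (skel M) e) \<in> component M U (Edge (edge M e))"
    "Vertex (tail (skel M) e) \<in> component M U (Vertex (head (skel M) e))"
    "Vertex (head (skel M) e) \<in> component M U (Vertex (tail (skel M) e))"
proof -
  have cells: "Vertex (tail (skel M) e) \<in> U" "Vertex (head (skel M) e) \<in> U" "Edge (edge M e) \<in> U"
    using assms by (auto simp: cells_def edges_def)
  have sub: "subface M (Vertex (tail (skel M) e)) (Edge (edge M e))"
    "subface M (Vertex (head (skel M) e)) (Edge (edge M e))"
    using assms by (auto simp: edge_def)
  show 1: "Vertex (tail (skel M) e) \<in> component M U (Edge (edge M e))"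
    using component_adjacent[OF component_refl cells(3,1)] sub by blast
  have 2: "Vertex (head (skel M) e) \<in> component M U (Edge (edge M e))"
    using component_adjacent[OF component_refl cells(3,2)] sub by blast
  show "Vertex (tail (skel M) e) \<in> component M U (Vertex (head (skel M) e))"
    "Vertex (head (skel M) e) \<in> component M U (Vertex (tail (skel M) e))"
    using 1 2 component_trans component_sym by metis+
qed

text \<open>
  Every cell that survives the cut lies on a face, so that each region arises from a flag.
  The flags in question are those that can be reached from one flag \<open>x0\<close> of the component when all
  edges may be crossed.
\<close>

lemma z_regions_conv:
  assumes Q: "Q \<subseteq> arcs (skel M)" "\<And>d. d \<in> Q \<Longrightarrow> opp M d \<in> Q"
    and c0: "c0 \<in> cells M" "x0 \<in> cell_flags M c0"
    and X: "component M (cells M) c0 - (\<Union>x\<in>X. subgraph_cells M (chain_graph M x)) =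
        component M (cells M) c0 - cut_cells M Q"
  shows "z_regions M (component M (cells M) c0) X = region_of M Q ` {y. (x0, y) \<in> flag_conn M {}}"
proof -
  let ?T = "component M (cells M) c0" and ?U = "cells M - cut_cells M Q"
  have T: "?T \<subseteq> cells M" using component_subset[OF c0(1)] .
  have TU: "?T - cut_cells M Q = ?T \<inter> ?U" using T by blast
  have x0: "x0 \<in> flags M" using c0 cell_flags_subset by blast
  have comp: "component M (?T \<inter> ?U) c = component M ?U c" if "c \<in> ?T \<inter> ?U" for c
    using that component_Int[of c M c0 ?U] by blast
  have FU: "Face (face M x) \<in> ?T \<inter> ?U" if "(x0, x) \<in> flag_conn M {}" for x
  proof -
    have "x \<in> flags M" using that x0 flag_conn_flags by blast
    then show ?thesis
      using conn_component_cells[OF c0 that] Face_in_cells self_in_face by (auto simp: cut_cells_def)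
  qed
  have 1: "face_complex M (component M (?T \<inter> ?U) (Face (face M x))) = region_of M Q x"
    if "(x0, x) \<in> flag_conn M {}" for x
    unfolding region_of_def comp[OF FU[OF that]] ..
  have 2: "\<exists>x. (x0, x) \<in> flag_conn M {} \<and> component M (?T \<inter> ?U) c =
      component M (?T \<inter> ?U) (Face (face M x))" if c: "c \<in> ?T \<inter> ?U" for c
  proof -
    obtain x where x: "x \<in> cell_flags M c" "(x0, x) \<in> flag_conn M {}"
      using component_cells_flags[OF c0, of c] c by blast
    have "Face (face M x) \<in> component M (?T \<inter> ?U) c"
      using face_incident[of c x] x c FU[OF x(2)] component_refl[of c]
        component_adjacent[of c M "?T \<inter> ?U" c "Face (face M x)"] by blast
    then show ?thesis using component_eq x by metis
  qed
  show ?thesis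
    unfolding z_regions_def components_def X TU
  proof (intro equalityI subsetI)
    fix R assume "R \<in> face_complex M ` component M (?T \<inter> ?U) ` (?T \<inter> ?U)"
    then obtain c where c: "c \<in> ?T \<inter> ?U" "R = face_complex M (component M (?T \<inter> ?U) c)"
      by auto
    then obtain x where x: "(x0, x) \<in> flag_conn M {}"
      "component M (?T \<inter> ?U) c = component M (?T \<inter> ?U) (Face (face M x))"
      using 2 by meson
    have "R = region_of M Q x" using c(2) x(2) 1[OF x(1)] by simp
    then show "R \<in> region_of M Q ` {y. (x0, y) \<in> flag_conn M {}}" using x(1) by simp
  next
    fix R assume "R \<in> region_of M Q ` {y. (x0, y) \<in> flag_conn M {}}"
    then obtain y where y: "(x0, y) \<in> flag_conn M {}" "R = region_of M Q y" by auto
    have "R = face_complex M (component M (?T \<inter> ?U) (Face (face M y)))"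
      using y(2) 1[OF y(1)] by simp
    then show "R \<in> face_complex M ` component M (?T \<inter> ?U) ` (?T \<inter> ?U)"
      using imageI[OF imageI[OF FU[OF y(1)]]] by simp
  qed
qed

end

section \<open>Flags of the derived embedding\<close>

definition lift_flag :: "'g \<Rightarrow> 'd flag \<Rightarrow> ('d \<times> 'g) flag" where
  "lift_flag b x = ((fst x, b), snd x)"

lemma net_voltage_simps [simp]:
  "net_voltage A \<beta> [] = \<one>\<^bsub>A\<^esub>"
  "net_voltage A \<beta> (d # V) = \<beta> d \<otimes>\<^bsub>A\<^esub> net_voltage A \<beta> V"
  by (simp_all add: net_voltage_def)

lemma (in group) net_voltage_in_carrier:
  "(\<And>d. d \<in> set V \<Longrightarrow> \<beta> d \<in> carrier G) \<Longrightarrow> net_voltage G \<beta> V \<in> carrier G"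
  by (induction V) auto

lemma (in group) net_voltage_append:
  "(\<And>d. d \<in> set V \<union> set W \<Longrightarrow> \<beta> d \<in> carrier G) \<Longrightarrow>
    net_voltage G \<beta> (V @ W) = net_voltage G \<beta> V \<otimes> net_voltage G \<beta> W"
  by (induction V) (auto simp: m_assoc net_voltage_in_carrier)

context voltage_graph_embedding
begin

abbreviation "D \<equiv> derived_embedding M A \<alpha>"

sublocale D: cellular_embedding "derived_embedding M A \<alpha>"
  by (rule derived_cellular)

lemma lift_flag_in_flags [simp]:
  "lift_flag b x \<in> flags D \<longleftrightarrow> x \<in> flags M \<and> b \<in> carrier A"
  by (cases x) (auto simp: flags_def lift_flag_def)

lemma tail_lift_flag [simp]:
  "tail (derived_graph (skel M) A \<alpha>) (fst (lift_flag b x)) = (tail (skel M) (fst x), b)"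
  by (simp add: lift_flag_def)

lemma lift_flagE:
  assumes "y \<in> flags D"
  obtains b x where "y = lift_flag b x" "x \<in> flags M" "b \<in> carrier A"
proof -
  have "y = lift_flag (snd (fst y)) (fst (fst y), snd y)" by (simp add: lift_flag_def)
  then show ?thesis using that assms lift_flag_in_flags by metis
qed

lemma lift_flag_inject [simp]: "lift_flag b x = lift_flag c y \<longleftrightarrow> b = c \<and> x = y"
  by (auto simp: lift_flag_def prod_eq_iff)

lemma across_lift_flag:
  assumes "b \<in> carrier A"
  shows "across_corner D (lift_flag b x) = lift_flag b (across_corner M x)"
proof -
  have "inv_into UNIV (rot D) (d, b) = (inv_into UNIV (rot M) d, b)" for d
  proof -
    have "rot D (inv_into UNIV (rot M) d, b) = (d, b)"
      by (simp add: derived_rot assms rot_inv)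
    then show ?thesis using D.inv_rot by metis
  qed
  then show ?thesis
    by (cases x) (simp add: lift_flag_def derived_rot assms)
qed

lemma along_lift_flag:
  "x \<in> flags M \<Longrightarrow> b \<in> carrier A \<Longrightarrow>
    along_edge D (lift_flag b x) = lift_flag (b \<otimes>\<^bsub>A\<^esub> \<alpha> (fst x)) (along_edge M x)"
  by (cases x) (simp add: lift_flag_def flags_def derived_opp)

text \<open>
  The flags of the derived embedding form the derived graph of the flags below: a step along an
  edge has the voltage of the dart traversed, and the two other steps have trivial voltage.
\<close>

lemma flag_step_lift_iff:
  assumes "x \<in> flags M" "b \<in> carrier A"
  shows "(lift_flag b x, Y) \<in> flag_step D (Q \<times> carrier A) \<longleftrightarrow>
    Y = lift_flag (b \<otimes>\<^bsub>A\<^esub> \<alpha> (fst x)) (along_edge M x) \<or>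
    Y = lift_flag b (across_corner M x) \<or>
    Y = lift_flag b (fst x, \<not> snd x) \<and> fst x \<notin> Q"
  using assms lift_flag_in_flags[of b x]
  unfolding flag_step_def
  by (simp add: across_lift_flag along_lift_flag) (simp add: lift_flag_def)

lemma flag_steps_lift:
  assumes "x \<in> flags M" "b \<in> carrier A"
  shows "(lift_flag b x, lift_flag (b \<otimes>\<^bsub>A\<^esub> \<alpha> (fst x)) (along_edge M x)) \<in> flag_step D (Q \<times> carrier A)"
    and "(lift_flag b x, lift_flag b (across_corner M x)) \<in> flag_step D (Q \<times> carrier A)"
    and "fst x \<notin> Q \<Longrightarrow> (lift_flag b x, lift_flag b (fst x, \<not> snd x)) \<in> flag_step D (Q \<times> carrier A)"
  unfolding flag_step_lift_iff[OF assms] by simp_all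

lemma derived_conn_induct [consumes 3, case_names base along across flip]:
  assumes "(lift_flag b x, lift_flag c y) \<in> flag_conn D (Q \<times> carrier A)"
    and "x \<in> flags M" "b \<in> carrier A"
    and "R b x"
    and "\<And>c y. y \<in> flags M \<Longrightarrow> c \<in> carrier A \<Longrightarrow> R c y \<Longrightarrow>
      R (c \<otimes>\<^bsub>A\<^esub> \<alpha> (fst y)) (along_edge M y)"
    and "\<And>c y. y \<in> flags M \<Longrightarrow> c \<in> carrier A \<Longrightarrow> R c y \<Longrightarrow> R c (across_corner M y)"
    and "\<And>c y. y \<in> flags M \<Longrightarrow> c \<in> carrier A \<Longrightarrow> R c y \<Longrightarrow> fst y \<notin> Q \<Longrightarrow>
      R c (fst y, \<not> snd y)"
  shows "R c y"
proof -
  have "\<exists>c y. Y = lift_flag c y \<and> R c y"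
    if "(lift_flag b x, Y) \<in> flag_conn D (Q \<times> carrier A)" for Y
    using that
  proof (induction rule: rtrancl_induct)
    case base
    then show ?case using assms(4) by blast
  next
    case (step Y Z)
    then obtain c y where cy: "Y = lift_flag c y" "R c y" by blast
    then have "y \<in> flags M" "c \<in> carrier A"
      using D.flag_step_flags[OF step.hyps(2)] by auto
    then show ?case
      using step.hyps(2) cy assms(5-7)[of y c] unfolding cy flag_step_lift_iff[OF \<open>y \<in> flags M\<close> \<open>c \<in> carrier A\<close>]
      by blast
  qed
  then show ?thesis using assms(1) lift_flag_inject by metis
qed

text \<open>
  Left multiplication of the layers by \<open>g\<close> is a deck transformation.
\<close>

lemma flag_conn_translate:
  assumes "(lift_flag b x, lift_flag c y) \<in> flag_conn D (Q \<times> carrier A)"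
    and "x \<in> flags M" "b \<in> carrier A" "g \<in> carrier A"
  shows "(lift_flag (g \<otimes>\<^bsub>A\<^esub> b) x, lift_flag (g \<otimes>\<^bsub>A\<^esub> c) y) \<in> flag_conn D (Q \<times> carrier A)"
  using assms(1-3)
proof (induction rule: derived_conn_induct)
  case base
  then show ?case by simp
next
  case (along c y)
  have "\<alpha> (fst y) \<in> carrier A" using along voltage_closed by (auto simp: flags_def)
  then have "g \<otimes>\<^bsub>A\<^esub> (c \<otimes>\<^bsub>A\<^esub> \<alpha> (fst y)) = (g \<otimes>\<^bsub>A\<^esub> c) \<otimes>\<^bsub>A\<^esub> \<alpha> (fst y)"
    using along assms(4) by (simp add: A.m_assoc)
  then show ?case
    using rtrancl_into_rtrancl[OF along(3) flag_steps_lift(1)] along assms(4) by simp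
next
  case (across c y)
  then show ?case
    using rtrancl_into_rtrancl[OF across(3) flag_steps_lift(2)] assms(4) by simp
next
  case (flip c y)
  then show ?case
    using rtrancl_into_rtrancl[OF flip.IH flag_steps_lift(3)] flip.hyps assms(4) by simp
qed

lemma flag_conn_translate_iff:
  assumes "x \<in> flags M" "b \<in> carrier A" "c \<in> carrier A" "g \<in> carrier A"
  shows "(lift_flag (g \<otimes>\<^bsub>A\<^esub> b) x, lift_flag (g \<otimes>\<^bsub>A\<^esub> c) y) \<in> flag_conn D (Q \<times> carrier A) \<longleftrightarrow>
    (lift_flag b x, lift_flag c y) \<in> flag_conn D (Q \<times> carrier A)"
proof
  assume "(lift_flag (g \<otimes>\<^bsub>A\<^esub> b) x, lift_flag (g \<otimes>\<^bsub>A\<^esub> c) y) \<in> flag_conn D (Q \<times> carrier A)"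
  from flag_conn_translate[OF this, of "inv\<^bsub>A\<^esub> g"] assms
  show "(lift_flag b x, lift_flag c y) \<in> flag_conn D (Q \<times> carrier A)"
    by (simp add: A.m_assoc[symmetric])
qed (use flag_conn_translate assms in blast)

lemma flag_conn_lift:
  assumes "(x, y) \<in> flag_conn M Q" "x \<in> flags M" "b \<in> carrier A"
  shows "\<exists>c\<in>carrier A. (lift_flag b x, lift_flag c y) \<in> flag_conn D (Q \<times> carrier A)"
  using assms(1)
proof (induction rule: rtrancl_induct)
  case base
  then show ?case using assms by blast
next
  case (step y w)
  then obtain c where c: "c \<in> carrier A" "(lift_flag b x, lift_flag c y) \<in> flag_conn D (Q \<times> carrier A)"
    by blast
  have y: "y \<in> flags M" using step flag_step_flags by blast
  then have "c \<otimes>\<^bsub>A\<^esub> \<alpha> (fst y) \<in> carrier A" using c voltage_closed by (auto simp: flags_def)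
  moreover have "\<exists>c'\<in>{c, c \<otimes>\<^bsub>A\<^esub> \<alpha> (fst y)}. (lift_flag c y, lift_flag c' w) \<in> flag_step D (Q \<times> carrier A)"
    using step.hyps(2) unfolding flag_step_lift_iff[OF y c(1)] by (auto simp: flag_step_def)
  ultimately obtain c' where c': "c' \<in> carrier A"
    "(lift_flag c y, lift_flag c' w) \<in> flag_step D (Q \<times> carrier A)"
    using c by blast
  then show ?case using rtrancl_into_rtrancl[OF c(2) c'(2)] by blast
qed

text \<open>
  The local group at \<open>x\<close> of the voltage graph formed by the flags: a closed walk of flags at \<open>x\<close> has
  net voltage \<open>g\<close> exactly if its lift starting in layer \<open>\<one>\<close> ends in layer \<open>g\<close>.
\<close>

definition return_voltages :: "'d set \<Rightarrow> 'd flag \<Rightarrow> 'g set" where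
  "return_voltages Q x = {g \<in> carrier A.
     (lift_flag \<one>\<^bsub>A\<^esub> x, lift_flag g x) \<in> flag_conn D (Q \<times> carrier A)}"

text \<open>
  The components over a connected voltage graph are the cosets of its local group.  Here the flags
  of the surface cut along \<open>Q\<close> form a connected graph with local group \<open>return_voltages Q x\<close>,
  and only the layers reached from \<open>a\<close> when \<open>Q\<close> may be crossed are of interest.
\<close>

lemma card_regions:
  assumes Q: "Q \<subseteq> arcs (skel M)" "\<And>d. d \<in> Q \<Longrightarrow> opp M d \<in> Q"
    and conn: "\<And>y. y \<in> flags M \<Longrightarrow> (x, y) \<in> flag_conn M Q"
    and x: "x \<in> flags M" and a: "a \<in> carrier A"
  shows "card (region_of D (Q \<times> carrier A) ` {Y. (lift_flag a x, Y) \<in> flag_conn D {}}) *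
      card (return_voltages Q x) = card (return_voltages {} x)"
proof -
  let ?r = "region_of D (Q \<times> carrier A)" and ?H = "return_voltages {} x"
    and ?L = "return_voltages Q x"
  let ?f = "\<lambda>h. ?r (lift_flag (a \<otimes>\<^bsub>A\<^esub> h) x)"
  have QD: "Q \<times> carrier A \<subseteq> arcs (skel D)" "\<And>d. d \<in> Q \<times> carrier A \<Longrightarrow> opp D d \<in> Q \<times> carrier A"
    using Q voltage_closed by (auto simp: derived_opp subset_iff)
  have r_eq: "?r (lift_flag b u) = ?r (lift_flag c y) \<longleftrightarrow>
      (lift_flag b u, lift_flag c y) \<in> flag_conn D (Q \<times> carrier A)"
    if "b \<in> carrier A" "c \<in> carrier A" "u \<in> flags M" "y \<in> flags M" for b c u y
    using that D.region_of_eq_iff[OF QD] by simp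
  have weaken: "(X, Y) \<in> flag_conn D (Q \<times> carrier A) \<Longrightarrow> (X, Y) \<in> flag_conn D {}" for X Y
    using D.flag_conn_mono[of "{}" "Q \<times> carrier A"] by blast
  have H: "h \<in> ?H \<longleftrightarrow> h \<in> carrier A \<and> (lift_flag a x, lift_flag (a \<otimes>\<^bsub>A\<^esub> h) x) \<in> flag_conn D {}" for h
    using flag_conn_translate_iff[of x "\<one>\<^bsub>A\<^esub>" h a x "{}"] a x
    by (auto simp: return_voltages_def)
  \<comment> \<open>Below, every flag is joined to \<open>x\<close> off the cut, so each region contains a lift of \<open>x\<close>.\<close>
  have image: "?r ` {Y. (lift_flag a x, Y) \<in> flag_conn D {}} = ?f ` ?H"
  proof (intro equalityI subsetI)
    fix R assume "R \<in> ?r ` {Y. (lift_flag a x, Y) \<in> flag_conn D {}}"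
    then obtain Y where Y: "R = ?r Y" "(lift_flag a x, Y) \<in> flag_conn D {}" by blast
    then have "Y \<in> flags D" using D.flag_conn_flags x a by fastforce
    then obtain c y where cy: "Y = lift_flag c y" "y \<in> flags M" "c \<in> carrier A"
      by (rule lift_flagE)
    obtain b where b: "b \<in> carrier A"
      "(lift_flag c y, lift_flag b x) \<in> flag_conn D (Q \<times> carrier A)"
      using flag_conn_lift[of y x Q c] conn[OF cy(2)] flag_conn_sym cy by blast
    define h where "h = inv\<^bsub>A\<^esub> a \<otimes>\<^bsub>A\<^esub> b"
    have h: "h \<in> carrier A" "a \<otimes>\<^bsub>A\<^esub> h = b"
      using a b by (auto simp: h_def A.m_assoc[symmetric])
    have "(lift_flag a x, lift_flag b x) \<in> flag_conn D {}"
      using Y(2) weaken[OF b(2)] cy by (auto intro: rtrancl_trans)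
    then have "h \<in> ?H" using H h by simp
    moreover have "R = ?f h" using r_eq[of c b y x] b cy x Y h by simp
    ultimately show "R \<in> ?f ` ?H" by blast
  next
    fix R assume "R \<in> ?f ` ?H"
    then show "R \<in> ?r ` {Y. (lift_flag a x, Y) \<in> flag_conn D {}}" using H by auto
  qed
  have fin: "finite ?H" using finite_group by (simp add: return_voltages_def)
  \<comment> \<open>The layers of the lifts of \<open>x\<close> in one region form a coset \<open>a h L\<close>.\<close>
  have fibre: "card {h' \<in> ?H. ?f h' = ?f h} = card ?L" if h: "h \<in> ?H" for h
  proof -
    have hc: "h \<in> carrier A" using h H by blast
    have "{h' \<in> ?H. ?f h' = ?f h} = (\<lambda>l. h \<otimes>\<^bsub>A\<^esub> l) ` ?L"
    proof (intro equalityI subsetI)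
      fix h' assume h': "h' \<in> {h' \<in> ?H. ?f h' = ?f h}"
      then have h'c: "h' \<in> carrier A" using H by blast
      define l where "l = inv\<^bsub>A\<^esub> h \<otimes>\<^bsub>A\<^esub> h'"
      have l: "l \<in> carrier A" "h \<otimes>\<^bsub>A\<^esub> l = h'"
        using hc h'c by (auto simp: l_def A.m_assoc[symmetric])
      have "(lift_flag (a \<otimes>\<^bsub>A\<^esub> h) x, lift_flag (a \<otimes>\<^bsub>A\<^esub> h') x) \<in> flag_conn D (Q \<times> carrier A)"
        using r_eq[of "a \<otimes>\<^bsub>A\<^esub> h" "a \<otimes>\<^bsub>A\<^esub> h'" x x] h' a x hc h'c by simp
      then have "(lift_flag h x, lift_flag h' x) \<in> flag_conn D (Q \<times> carrier A)"
        using flag_conn_translate_iff a x hc h'c by blast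
      then have "(lift_flag (h \<otimes>\<^bsub>A\<^esub> \<one>\<^bsub>A\<^esub>) x, lift_flag (h \<otimes>\<^bsub>A\<^esub> l) x) \<in> flag_conn D (Q \<times> carrier A)"
        using l hc by simp
      then have "l \<in> ?L"
        using flag_conn_translate_iff[of x "\<one>\<^bsub>A\<^esub>" l h x Q] x l hc by (simp add: return_voltages_def)
      then show "h' \<in> (\<lambda>l. h \<otimes>\<^bsub>A\<^esub> l) ` ?L" using l by blast
    next
      fix h' assume "h' \<in> (\<lambda>l. h \<otimes>\<^bsub>A\<^esub> l) ` ?L"
      then obtain l where l: "l \<in> ?L" "h' = h \<otimes>\<^bsub>A\<^esub> l" by blast
      then have lc: "l \<in> carrier A" by (simp add: return_voltages_def)
      have 1: "(lift_flag (a \<otimes>\<^bsub>A\<^esub> h) x, lift_flag (a \<otimes>\<^bsub>A\<^esub> h') x) \<in> flag_conn D (Q \<times> carrier A)"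
        using flag_conn_translate_iff[of x "\<one>\<^bsub>A\<^esub>" l "a \<otimes>\<^bsub>A\<^esub> h" x Q] l lc x a hc
        by (simp add: return_voltages_def A.m_assoc)
      have "h' \<in> ?H" using h weaken[OF 1] H lc hc l(2) by (auto intro: rtrancl_trans)
      moreover have "?f h' = ?f h" using 1 r_eq[of "a \<otimes>\<^bsub>A\<^esub> h" "a \<otimes>\<^bsub>A\<^esub> h'" x x] a x hc lc l by simp
      ultimately show "h' \<in> {h' \<in> ?H. ?f h' = ?f h}" by blast
    qed
    moreover have "inj_on (\<lambda>l. h \<otimes>\<^bsub>A\<^esub> l) ?L"
      using hc by (auto simp: inj_on_def return_voltages_def)
    ultimately show ?thesis by (simp add: card_image)
  qed
  have "card ?H = (\<Sum>R\<in>?f ` ?H. card {h \<in> ?H. ?f h = R})"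
    using sum.image_gen[OF fin, of "\<lambda>_. 1::nat" ?f] by simp
  also have "\<dots> = (\<Sum>R\<in>?f ` ?H. card ?L)"
    using fibre by (intro sum.cong) auto
  finally show ?thesis using image by simp
qed

text \<open>
  With every edge open, all flags at a vertex are joined by steps of trivial voltage, so a walk of
  flags can follow any walk of the graph, each dart being traversed by one step along its edge.
\<close>

lemma lift_walk_flags:
  assumes "pre_digraph.awalk (skel M) u V u'" "x \<in> flags M" "y \<in> flags M"
    "tail (skel M) (fst x) = u" "tail (skel M) (fst y) = u'" "b \<in> carrier A"
  shows "(lift_flag b x, lift_flag (b \<otimes>\<^bsub>A\<^esub> net_voltage A \<alpha> V) y) \<in> flag_conn D {}"
  using assms
proof (induction V arbitrary: u x b)
  case Nil
  then have "u = u'" by (simp add: awalk_Nil_iff)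
  then show ?case
    using Nil D.vertex_flags_conn[of "lift_flag b x" "lift_flag b y" "{}"] by simp
next
  case (Cons d V)
  then have d: "d \<in> arcs (skel M)" "tail (skel M) d = u" "awalk (head (skel M) d) V u'"
    by (auto simp: awalk_Cons_iff)
  have V: "net_voltage A \<alpha> V \<in> carrier A"
    using d(3) voltage_closed by (intro A.net_voltage_in_carrier) (auto simp: awalk_def)
  have dt: "(d, True) \<in> flags M" using d by (simp add: flags_def)
  have 1: "(lift_flag b x, lift_flag b (d, True)) \<in> flag_conn D {}"
    using Cons.prems d dt D.vertex_flags_conn[of "lift_flag b x" "lift_flag b (d, True)" "{}"]
    by simp
  have 2: "(lift_flag b (d, True), lift_flag (b \<otimes>\<^bsub>A\<^esub> \<alpha> d) (along_edge M (d, True))) \<in> flag_conn D {}"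
    using r_into_rtrancl[OF flag_steps_lift(1)[OF dt Cons.prems(6), of "{}"]]
    by (simp del: along_edge.simps)
  have 3: "(lift_flag (b \<otimes>\<^bsub>A\<^esub> \<alpha> d) (along_edge M (d, True)),
      lift_flag (b \<otimes>\<^bsub>A\<^esub> \<alpha> d \<otimes>\<^bsub>A\<^esub> net_voltage A \<alpha> V) y) \<in> flag_conn D {}"
    using Cons.prems d voltage_closed[OF d(1)] along_flags[OF dt]
    by (intro Cons.IH) auto
  show ?case
    using rtrancl_trans[OF rtrancl_trans[OF 1 2] 3] Cons.prems V voltage_closed[OF d(1)]
    by (simp add: A.m_assoc)
qed

lemma walk_of_conn:
  assumes "(lift_flag b x, lift_flag c y) \<in> flag_conn D (Q \<times> carrier A)" "x \<in> flags M" "b \<in> carrier A"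
  shows "\<exists>V. pre_digraph.awalk (skel M) (tail (skel M) (fst x)) V (tail (skel M) (fst y)) \<and>
    c = b \<otimes>\<^bsub>A\<^esub> net_voltage A \<alpha> V"
  using assms
proof (induction rule: derived_conn_induct)
  case base
  then show ?case using assms by (intro exI[of _ "[]"]) (auto simp: awalk_Nil_iff flags_def)
next
  case (along c y)
  then obtain V where V: "awalk (tail (skel M) (fst x)) V (tail (skel M) (fst y))"
    "c = b \<otimes>\<^bsub>A\<^esub> net_voltage A \<alpha> V" by blast
  have y: "fst y \<in> arcs (skel M)" using along by (auto simp: flags_def)
  have "awalk (tail (skel M) (fst y)) [fst y] (head (skel M) (fst y))"
    using y by (simp add: awalk_Cons_iff awalk_Nil_iff)
  then have "awalk (tail (skel M) (fst x)) (V @ [fst y]) (head (skel M) (fst y))"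
    using V awalk_appendI by blast
  moreover have "head (skel M) (fst y) = tail (skel M) (fst (along_edge M y))"
    using y by (cases y) simp
  moreover have vs: "\<And>d. d \<in> set V \<Longrightarrow> \<alpha> d \<in> carrier A"
    using V(1) voltage_closed by (auto simp: awalk_def)
  then have "net_voltage A \<alpha> (V @ [fst y]) = net_voltage A \<alpha> V \<otimes>\<^bsub>A\<^esub> \<alpha> (fst y)"
    using voltage_closed[OF y] by (subst A.net_voltage_append) auto
  ultimately show ?case
    using V assms(3) voltage_closed[OF y] A.net_voltage_in_carrier[of V \<alpha>] vs
    by (intro exI[of _ "V @ [fst y]"]) (auto simp: A.m_assoc)
next
  case (across c y)
  then show ?case by (simp add: tail_across del: across_corner.simps)
next
  case (flip c y)
  then show ?case by simp
qed

lemma local_group_conv: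
  assumes "x \<in> flags M" "tail (skel M) (fst x) = u"
  shows "local_group A (skel M) \<alpha> u = return_voltages {} x"
proof (intro equalityI subsetI)
  fix g assume "g \<in> local_group A (skel M) \<alpha> u"
  then obtain V where V: "awalk u V u" "g = net_voltage A \<alpha> V" by (auto simp: local_group_def)
  have "g \<in> carrier A"
    using V voltage_closed by (auto intro!: A.net_voltage_in_carrier simp: awalk_def)
  then show "g \<in> return_voltages {} x"
    using lift_walk_flags[OF V(1) assms(1,1,2,2) A.one_closed] V by (simp add: return_voltages_def)
next
  fix g assume g: "g \<in> return_voltages {} x"
  then obtain V where V: "awalk u V u" "g = \<one>\<^bsub>A\<^esub> \<otimes>\<^bsub>A\<^esub> net_voltage A \<alpha> V"
    using walk_of_conn[of "\<one>\<^bsub>A\<^esub>" x g x "{}"] assms by (auto simp: return_voltages_def)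
  have "net_voltage A \<alpha> V \<in> carrier A"
    using V voltage_closed by (auto intro!: A.net_voltage_in_carrier simp: awalk_def)
  then show "g \<in> local_group A (skel M) \<alpha> u" using V by (auto simp: local_group_def)
qed

end

section \<open>Walks in the subdivided medial graph\<close>

definition curve_darts :: "('v, 'd) embedding \<Rightarrow> 'd chain \<Rightarrow> 'd set" where
  "curve_darts N z = {d \<in> arcs (skel N). z (edge N d) = 1}"

abbreviation passage :: "'d flag \<Rightarrow> 'd flag \<Rightarrow> ('d total_edge \<times> bool) list" where
  "passage x y \<equiv> [(Joint x, True), (Joint y, False)]"

text \<open>
  A crossing consists of a dart into a midpoint followed by a dart out of it.  Hence none can
  arise where two walks are joined at a corner.
\<close>

lemma not_crosses_append_passage:
  assumes "\<not> transversely_crosses N z V"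
    and "z (edge N (fst x)) = 1 \<Longrightarrow> edge_side N x = edge_side N y"
  shows "\<not> transversely_crosses N z (V @ passage x y)"
proof
  assume "transversely_crosses N z (V @ passage x y)"
  then obtain i p q where i: "Suc i < length (V @ passage x y)" "(V @ passage x y) ! i = (Joint p, True)"
      "(V @ passage x y) ! Suc i = (Joint q, False)"
      "z (edge N (fst p)) = 1" "edge_side N p \<noteq> edge_side N q"
    unfolding transversely_crosses_def by blast
  then have "Suc i < length V + 2" by simp
  then consider "Suc i < length V" | "Suc i = length V" | "i = length V" by linarith
  then show False
  proof cases
    case 1
    then have "V ! i = (Joint p, True)" "V ! Suc i = (Joint q, False)"
      using i by (simp_all add: nth_append)
    then show ?thesis using assms(1) i 1 unfolding transversely_crosses_def by blast
  next
    case 2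
    then show ?thesis using i(3) by (simp add: nth_append)
  next
    case 3
    then have "p = x" "q = y" using i by (simp_all add: nth_append)
    then show ?thesis using i assms(2) by simp
  qed
qed

lemma not_crosses_Cons_Cons:
  assumes "\<not> transversely_crosses N z ((Joint x, True) # (Joint y, False) # V)"
  shows "z (edge N (fst x)) = 1 \<Longrightarrow> edge_side N x = edge_side N y"
    and "\<not> transversely_crosses N z V"
proof -
  let ?V = "(Joint x, True) # (Joint y, False) # V"
  show "edge_side N x = edge_side N y" if "z (edge N (fst x)) = 1"
  proof (rule ccontr)
    assume "edge_side N x \<noteq> edge_side N y"
    then have "transversely_crosses N z ?V"
      unfolding transversely_crosses_def using that by (intro exI[of _ 0] exI[of _ x] exI[of _ y]) simp
    then show False using assms by blast
  qed
  show "\<not> transversely_crosses N z V"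
  proof
    assume "transversely_crosses N z V"
    then obtain i p q where "Suc i < length V" "V ! i = (Joint p, True)" "V ! Suc i = (Joint q, False)"
      "z (edge N (fst p)) = 1" "edge_side N p \<noteq> edge_side N q"
      unfolding transversely_crosses_def by blast
    then have "transversely_crosses N z ?V"
      unfolding transversely_crosses_def
      by (intro exI[of _ "Suc (Suc i)"] exI[of _ p] exI[of _ q]) simp
    then show False using assms by blast
  qed
qed

context cellular_embedding
begin

abbreviation "M' \<equiv> subdivided_medial_graph M"

lemma medial_simps:
  "arcs M' = Joint ` flags M \<times> UNIV"
  "verts M' = Midpoint ` edges M \<union> Corner ` corners M"
  "tail M' (Joint x, b) = (if b then Corner (corner M x) else Midpoint (edge M (fst x)))"
  "head M' (Joint x, b) = (if b then Midpoint (edge M (fst x)) else Corner (corner M x))"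
  by (simp_all add: subdivided_medial_graph_def total_graph_def)

lemma wf_medial: "wf_digraph M'"
  by unfold_locales (auto simp: medial_simps corners_def edges_def flags_def)

lemma edge_eq_iff: "edge M d = edge M d' \<longleftrightarrow> d' \<in> edge M d"
  by (auto simp: edge_def doubleton_eq_iff)

lemma corner_across: "corner M (across_corner M x) = corner M x"
  by (auto simp: corner_def across_across)

lemma corner_eqD: "corner M x = corner M y \<Longrightarrow> y = x \<or> y = across_corner M x"
  by (auto simp: corner_def doubleton_eq_iff)

lemma edge_side_along: "x \<in> flags M \<Longrightarrow> edge_side M (along_edge M x) = edge_side M x"
  by (auto simp: edge_side_def along_along simp del: along_edge.simps)

lemma edge_side_eqD: "edge_side M x = edge_side M y \<Longrightarrow> y = x \<or> y = along_edge M x"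
  by (auto simp: edge_side_def doubleton_eq_iff simp del: along_edge.simps)

lemma fst_along [simp]: "fst (along_edge M x) = opp M (fst x)"
  by (cases x) simp

lemma awalk_passage:
  assumes "x \<in> flags M" "y \<in> flags M" "fst y \<in> edge M (fst x)"
  shows "pre_digraph.awalk M' (Corner (corner M x)) (passage x y) (Corner (corner M y))"
proof -
  interpret M': wf_digraph M' by (rule wf_medial)
  have "edge M (fst x) = edge M (fst y)" using assms edge_eq_iff by blast
  then show ?thesis
    using assms by (auto simp: M'.awalk_Cons_iff M'.awalk_Nil_iff medial_simps corners_def)
qed

text \<open>
  The subdivided medial graph is bipartite between corners and midpoints, so that a walk between
  corners is a sequence of passages from a flag to another flag of the same edge.
\<close>

lemma medial_walk_Cons:
  assumes "pre_digraph.awalk M' (Corner C) (e # V) (Corner C')"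
  obtains x y V' where "e # V = passage x y @ V'" "x \<in> flags M" "y \<in> flags M"
    "corner M x = C" "fst y \<in> edge M (fst x)" "pre_digraph.awalk M' (Corner (corner M y)) V' (Corner C')"
proof -
  interpret M': wf_digraph M' by (rule wf_medial)
  have e: "e \<in> arcs M'" "tail M' e = Corner C" "M'.awalk (head M' e) V (Corner C')"
    using assms by (auto simp: M'.awalk_Cons_iff)
  then obtain x b where x: "e = (Joint x, b)" "x \<in> flags M" by (auto simp: medial_simps)
  then have b: "b" "corner M x = C" using e by (auto simp: medial_simps split: if_splits)
  then have V: "M'.awalk (Midpoint (edge M (fst x))) V (Corner C')"
    using e x by (simp add: medial_simps)
  then obtain e' V' where V': "V = e' # V'" by (cases V) (auto simp: M'.awalk_Nil_iff)
  have e': "e' \<in> arcs M'" "tail M' e' = Midpoint (edge M (fst x))" "M'.awalk (head M' e') V' (Corner C')"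
    using V by (auto simp: V' M'.awalk_Cons_iff)
  then obtain y b' where y: "e' = (Joint y, b')" "y \<in> flags M" by (auto simp: medial_simps)
  then have b': "\<not> b'" "edge M (fst x) = edge M (fst y)"
    using e' by (auto simp: medial_simps split: if_splits)
  have "fst y \<in> edge M (fst x)" using b'(2) edge_eq_iff by blast
  then show ?thesis
    using that[of x y V'] x b V' y b'(1) e'(3) by (simp add: medial_simps)
qed

end

context voltage_graph_embedding
begin

lemma curve_darts_closed:
  "curve_darts M z \<subseteq> arcs (skel M)" "d \<in> curve_darts M z \<Longrightarrow> opp M d \<in> curve_darts M z"
  by (auto simp: curve_darts_def edge_def insert_commute)

context
  fixes P :: "'d set"
  assumes P: "preferred_directions M P"
begin

abbreviation "\<alpha>' \<equiv> extended_voltage A \<alpha> P"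

lemma extended_voltage_closed: "e \<in> arcs M' \<Longrightarrow> \<alpha>' e \<in> carrier A"
  using voltage_closed by (auto simp: medial_simps extended_voltage_def Let_def flags_def)

text \<open>
  Exactly one of the two darts of an edge is preferred.  A passage from the end of \<open>d\<close> to the opposite
  end picks up \<open>\<alpha> d\<close> on its way in if \<open>d\<close> is preferred, and otherwise the inverse of the
  voltage of the dart opposite to \<open>d\<close> on its way out, which is \<open>\<alpha> d\<close> again.
\<close>

lemma passage_voltage:
  assumes "x \<in> flags M" "fst y = fst x \<or> fst y = opp M (fst x)"
  shows "net_voltage A \<alpha>' (passage x y) = (if fst y = fst x then \<one>\<^bsub>A\<^esub> else \<alpha> (fst x))"
proof -
  have d: "fst x \<in> arcs (skel M)" using assms(1) by (auto simp: flags_def)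
  have P': "fst x \<in> P \<longleftrightarrow> opp M (fst x) \<notin> P" "opp M (fst x) \<noteq> fst x"
    using P d arev_neq[OF d] unfolding preferred_directions_def by blast+
  have c: "\<alpha> (fst x) \<in> carrier A" "\<alpha> (opp M (fst x)) = inv\<^bsub>A\<^esub> \<alpha> (fst x)"
    using voltage_closed[OF d] voltage_opp[OF d] by auto
  show ?thesis
  proof (cases "fst y = fst x")
    case True
    then show ?thesis using c(1) by (simp add: extended_voltage_def Let_def)
  next
    case False
    then have "fst y = opp M (fst x)" using assms(2) by blast
    then show ?thesis using False P' c by (cases "fst x \<in> P") (simp_all add: extended_voltage_def Let_def)
  qed
qed

text \<open>
  A step across a corner does not move the corner vertex, and the two other permitted steps are
  passages that stay on one side of the edge or go through an edge that is not in \<open>G[z]\<close>.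
\<close>

lemma noncrossing_walk_of_conn:
  assumes "(lift_flag b x, lift_flag c y) \<in> flag_conn D (curve_darts M z \<times> carrier A)"
    and "x \<in> flags M" "b \<in> carrier A"
  shows "\<exists>V. pre_digraph.awalk M' (Corner (corner M x)) V (Corner (corner M y)) \<and>
    \<not> transversely_crosses M z V \<and> c = b \<otimes>\<^bsub>A\<^esub> net_voltage A \<alpha>' V"
proof -
  interpret M': wf_digraph M' by (rule wf_medial)
  \<comment> \<open>Extension of a walk by the passage that imitates one more step of flags.\<close>
  have ext: "\<exists>V. M'.awalk (Corner (corner M x)) V (Corner (corner M y')) \<and>
      \<not> transversely_crosses M z V \<and> c \<otimes>\<^bsub>A\<^esub> g = b \<otimes>\<^bsub>A\<^esub> net_voltage A \<alpha>' V"
    if V: "M'.awalk (Corner (corner M x)) V (Corner (corner M y))"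
      "\<not> transversely_crosses M z V" "c = b \<otimes>\<^bsub>A\<^esub> net_voltage A \<alpha>' V"
      and y: "y \<in> flags M" "y' \<in> flags M" "fst y' \<in> edge M (fst y)"
      and cross: "z (edge M (fst y)) = 1 \<Longrightarrow> edge_side M y = edge_side M y'"
      and g: "net_voltage A \<alpha>' (passage y y') = g"
    for V c y y' g
  proof (intro exI conjI)
    have p: "M'.awalk (Corner (corner M y)) (passage y y') (Corner (corner M y'))"
      by (rule awalk_passage[OF y])
    show "M'.awalk (Corner (corner M x)) (V @ passage y y') (Corner (corner M y'))"
      using M'.awalk_appendI[OF V(1) p] .
    show "\<not> transversely_crosses M z (V @ passage y y')"
      using not_crosses_append_passage[OF V(2) cross] .
    have vc: "\<And>e. e \<in> set V \<union> set (passage y y') \<Longrightarrow> \<alpha>' e \<in> carrier A"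
      using V(1) p extended_voltage_closed unfolding M'.awalk_def by blast
    then have "net_voltage A \<alpha>' V \<in> carrier A" "net_voltage A \<alpha>' (passage y y') \<in> carrier A"
      by (auto intro!: A.net_voltage_in_carrier simp del: net_voltage_simps)
    then show "c \<otimes>\<^bsub>A\<^esub> g = b \<otimes>\<^bsub>A\<^esub> net_voltage A \<alpha>' (V @ passage y y')"
      using A.net_voltage_append[of V "passage y y'" \<alpha>'] vc V(3) g assms(3)
      by (simp only: A.m_assoc)
  qed
  show ?thesis
    using assms
  proof (induction rule: derived_conn_induct)
    case base
    show ?case
      using assms
      by (intro exI[of _ "[]"]) (auto simp: M'.awalk_Nil_iff medial_simps corners_def
          transversely_crosses_def)
  next
    case (along c y)
    then obtain V where V: "M'.awalk (Corner (corner M x)) V (Corner (corner M y))"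
      "\<not> transversely_crosses M z V" "c = b \<otimes>\<^bsub>A\<^esub> net_voltage A \<alpha>' V" by blast
    have "opp M (fst y) \<noteq> fst y" using along arev_neq by (auto simp: flags_def)
    then have "net_voltage A \<alpha>' (passage y (along_edge M y)) = \<alpha> (fst y)"
      using passage_voltage[of y "along_edge M y"] along
      by (simp del: net_voltage_simps along_edge.simps)
    then show ?case
      using along along_flags[of y] edge_side_along[of y]
      by (intro ext[OF V]) (auto simp: edge_def simp del: net_voltage_simps along_edge.simps)
  next
    case (across c y)
    then show ?case by (simp add: corner_across del: across_corner.simps)
  next
    case (flip c y)
    then obtain V where V: "M'.awalk (Corner (corner M x)) V (Corner (corner M y))"
      "\<not> transversely_crosses M z V" "c = b \<otimes>\<^bsub>A\<^esub> net_voltage A \<alpha>' V" by blast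
    have y': "(fst y, \<not> snd y) \<in> flags M" "z (edge M (fst y)) \<noteq> 1"
      using flip by (auto simp: flags_def curve_darts_def)
    have "net_voltage A \<alpha>' (passage y (fst y, \<not> snd y)) = \<one>\<^bsub>A\<^esub>"
      using passage_voltage[of y "(fst y, \<not> snd y)"] flip by (simp del: net_voltage_simps)
    from ext[OF V flip.hyps(1) y'(1) _ _ this] y'(2) flip
    show ?case by (simp add: edge_def del: net_voltage_simps)
  qed
qed

text \<open>
  A passage that does not cross \<open>G[z]\<close> joins two flags on the same side of an edge of \<open>G[z]\<close>, or any two
  flags of another edge, and in both cases steps of flags with the same voltage join them.
  The flag at which a passage starts may be either of the two flags in the corner just reached.
\<close>

lemma conn_of_noncrossing_walk:
  assumes "pre_digraph.awalk M' (Corner (corner M x)) V (Corner (corner M y))"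
    and "\<not> transversely_crosses M z V" "x \<in> flags M" "y \<in> flags M" "b \<in> carrier A"
  shows "(lift_flag b x, lift_flag (b \<otimes>\<^bsub>A\<^esub> net_voltage A \<alpha>' V) y)
    \<in> flag_conn D (curve_darts M z \<times> carrier A)"
  using assms
proof (induction "length V" arbitrary: V x b rule: less_induct)
  case less
  interpret M': wf_digraph M' by (rule wf_medial)
  let ?Q = "curve_darts M z"
  have corner: "(lift_flag c u, lift_flag c w) \<in> flag_conn D (?Q \<times> carrier A)"
    if "corner M u = corner M w" "u \<in> flags M" "c \<in> carrier A" for u w c
    using corner_eqD[OF that(1)] r_into_rtrancl[OF flag_steps_lift(2)[OF that(2,3)]] by auto
  show ?case
  proof (cases V)
    case Nil
    then have "corner M x = corner M y" using less.prems(1) by (simp add: M'.awalk_Nil_iff)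
    then show ?thesis using corner less.prems Nil by simp
  next
    case (Cons e V1)
    obtain p q V' where pq: "e # V1 = passage p q @ V'" "p \<in> flags M" "q \<in> flags M"
      "corner M p = corner M x" "fst q \<in> edge M (fst p)"
      "M'.awalk (Corner (corner M q)) V' (Corner (corner M y))"
      using medial_walk_Cons[OF less.prems(1)[unfolded Cons]] by metis
    have nc: "z (edge M (fst p)) = 1 \<Longrightarrow> edge_side M p = edge_side M q"
      "\<not> transversely_crosses M z V'"
      using not_crosses_Cons_Cons[of M z p q V'] less.prems(2) Cons pq(1) by auto
    let ?g = "net_voltage A \<alpha>' (passage p q)"
    have q: "fst q = fst p \<or> fst q = opp M (fst p)" using pq(5) by (auto simp: edge_def)
    have d: "fst p \<in> arcs (skel M)" using pq by (auto simp: flags_def)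
    have neq: "opp M (fst p) \<noteq> fst p" using d arev_neq by blast
    have g: "?g = (if fst q = fst p then \<one>\<^bsub>A\<^esub> else \<alpha> (fst p))" by (rule passage_voltage[OF pq(2) q])
    have gc: "?g \<in> carrier A" using voltage_closed[OF d] unfolding g by simp
    have flip: "(lift_flag c (fst u, s), lift_flag c u) \<in> flag_conn D (?Q \<times> carrier A)"
      if "u \<in> flags M" "fst u \<notin> ?Q" "c \<in> carrier A" for u s c
    proof (cases "s = snd u")
      case False
      then have "u = (fst u, \<not> s)" by (simp add: prod_eq_iff)
      then show ?thesis
        using r_into_rtrancl[OF flag_steps_lift(3)[of "(fst u, s)" c ?Q]] that
        by (simp add: flags_def mem_Times_iff)
    qed simp
    have alongp: "(lift_flag b p, lift_flag (b \<otimes>\<^bsub>A\<^esub> \<alpha> (fst p)) (along_edge M p))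
        \<in> flag_conn D (?Q \<times> carrier A)"
      using r_into_rtrancl[OF flag_steps_lift(1)[OF pq(2) less.prems(5)]] .
    have step: "(lift_flag b p, lift_flag (b \<otimes>\<^bsub>A\<^esub> ?g) q) \<in> flag_conn D (?Q \<times> carrier A)"
    proof (cases "fst p \<in> ?Q")
      case True
      then have "q = p \<or> q = along_edge M p"
        using nc(1) edge_side_eqD[of p q] by (simp add: curve_darts_def del: along_edge.simps)
      then show ?thesis
        unfolding g using alongp less.prems(5) neq by (auto simp del: along_edge.simps)
    next
      case False
      have F: "opp M (fst p) \<notin> ?Q" using False curve_darts_closed(2)[of "opp M (fst p)" z] by auto
      show ?thesis
      proof (cases "fst q = fst p")
        case True
        then show ?thesis
          using flip[OF pq(3), of b "snd p"] False less.prems(5) unfolding g by simp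
      next
        case neq': False
        have "along_edge M p = (fst q, snd (along_edge M p))"
          using q neq' by (simp add: prod_eq_iff del: along_edge.simps)
        moreover have "(lift_flag (b \<otimes>\<^bsub>A\<^esub> \<alpha> (fst p)) (fst q, snd (along_edge M p)),
            lift_flag (b \<otimes>\<^bsub>A\<^esub> \<alpha> (fst p)) q) \<in> flag_conn D (?Q \<times> carrier A)"
          using q neq' F voltage_closed[OF d] less.prems(5) by (intro flip[OF pq(3)]) auto
        ultimately show ?thesis
          using alongp neq' unfolding g by (simp del: along_edge.simps)
      qed
    qed
    have V'c: "net_voltage A \<alpha>' V' \<in> carrier A"
      using pq(6) extended_voltage_closed unfolding M'.awalk_def
      by (intro A.net_voltage_in_carrier) blast
    have V: "V = passage p q @ V'" using Cons pq(1) by simp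
    have "set (passage p q @ V') \<subseteq> arcs M'"
      using less.prems(1) unfolding V M'.awalk_def by blast
    then have pc: "\<And>e. e \<in> set (passage p q) \<union> set V' \<Longrightarrow> \<alpha>' e \<in> carrier A"
      using extended_voltage_closed unfolding set_append by blast
    have "(lift_flag (b \<otimes>\<^bsub>A\<^esub> ?g) q, lift_flag (b \<otimes>\<^bsub>A\<^esub> ?g \<otimes>\<^bsub>A\<^esub> net_voltage A \<alpha>' V') y)
        \<in> flag_conn D (?Q \<times> carrier A)"
      using V pq nc(2) less.prems gc by (intro less.hyps) (auto simp del: net_voltage_simps)
    moreover have "b \<otimes>\<^bsub>A\<^esub> ?g \<otimes>\<^bsub>A\<^esub> net_voltage A \<alpha>' V' = b \<otimes>\<^bsub>A\<^esub> net_voltage A \<alpha>' V"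
      using A.net_voltage_append[of "passage p q" V' \<alpha>'] pc A.m_assoc[OF less.prems(5) gc V'c]
      by (simp only: V)
    moreover have "(lift_flag b x, lift_flag b p) \<in> flag_conn D (?Q \<times> carrier A)"
      using corner[of x p b] pq(4) less.prems by simp
    ultimately show ?thesis using step by (metis rtrancl_trans)
  qed
qed

lemma noncrossing_group_conv:
  assumes "x \<in> flags M"
  shows "noncrossing_group M A \<alpha> P (Corner (corner M x)) z = return_voltages (curve_darts M z) x"
proof (intro equalityI subsetI)
  interpret M': wf_digraph M' by (rule wf_medial)
  have closed: "net_voltage A \<alpha>' V \<in> carrier A" if "M'.awalk u V w" for u V w
    using that extended_voltage_closed unfolding M'.awalk_def
    by (intro A.net_voltage_in_carrier) blast
  {
    fix g assume "g \<in> noncrossing_group M A \<alpha> P (Corner (corner M x)) z"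
    then obtain V where V: "M'.awalk (Corner (corner M x)) V (Corner (corner M x))"
      "\<not> transversely_crosses M z V" "g = net_voltage A \<alpha>' V"
      by (auto simp: noncrossing_group_def)
    show "g \<in> return_voltages (curve_darts M z) x"
      using conn_of_noncrossing_walk[OF V(1,2) assms assms A.one_closed] closed[OF V(1)] V(3)
      by (simp add: return_voltages_def)
  next
    fix g assume "g \<in> return_voltages (curve_darts M z) x"
    then obtain V where V: "M'.awalk (Corner (corner M x)) V (Corner (corner M x))"
      "\<not> transversely_crosses M z V" "g = \<one>\<^bsub>A\<^esub> \<otimes>\<^bsub>A\<^esub> net_voltage A \<alpha>' V"
      using noncrossing_walk_of_conn[of "\<one>\<^bsub>A\<^esub>" x g x z] assms by (auto simp: return_voltages_def)
    then show "g \<in> noncrossing_group M A \<alpha> P (Corner (corner M x)) z"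
      using closed[OF V(1)] by (auto simp: noncrossing_group_def)
  }
qed

end

end

section \<open>Lifts of the cycle\<close>

lemma chain_graph_simps:
  "verts (chain_graph N z) = tail (skel N) ` curve_darts N z"
  "arcs (chain_graph N z) = curve_darts N z"
  "tail (chain_graph N z) = tail (skel N)"
  "head (chain_graph N z) = head (skel N)"
  by (simp_all add: chain_graph_def curve_darts_def Let_def)

lemma subgraph_cells_chain_graph: "subgraph_cells N (chain_graph N z) = cut_cells N (curve_darts N z)"
  by (simp add: subgraph_cells_def cut_cells_def chain_graph_simps image_comp)

context voltage_graph_embedding
begin

lemma preimage_simps:
  "verts (graph_preimage M A \<alpha> (chain_graph M z)) = tail (skel M) ` curve_darts M z \<times> carrier A"
  "arcs (graph_preimage M A \<alpha> (chain_graph M z)) = curve_darts M z \<times> carrier A"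
  "tail (graph_preimage M A \<alpha> (chain_graph M z)) = tail (skel D)"
  "head (graph_preimage M A \<alpha> (chain_graph M z)) = head (skel D)"
  by (simp_all add: graph_preimage_def chain_graph_simps)

lemma derived_curve_closed:
  "curve_darts M z \<times> carrier A \<subseteq> arcs (skel D)"
  "e \<in> curve_darts M z \<times> carrier A \<Longrightarrow> opp D e \<in> curve_darts M z \<times> carrier A"
  using curve_darts_closed voltage_closed by (auto simp: derived_opp subset_iff)

lemma curve_darts_lifted_chain:
  "e \<in> curve_darts D (lifted_chain M A \<alpha> z v b) \<longleftrightarrow>
    e \<in> arcs (skel D) \<and>
    (\<exists>e'\<in>curve_darts M z \<times> carrier A. edge D e = edge D e' \<and>
      (v, b) \<rightarrow>\<^sup>*\<^bsub>graph_preimage M A \<alpha> (chain_graph M z)\<^esub> tail (skel D) e' \<and>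
      (v, b) \<rightarrow>\<^sup>*\<^bsub>graph_preimage M A \<alpha> (chain_graph M z)\<^esub> head (skel D) e')"
  by (auto simp: curve_darts_def[of D] lifted_chain_def graph_chain_def graph_component_def
      preimage_simps simp del: derived_simps)

lemma curve_darts_lifted_chain_subset:
  "curve_darts D (lifted_chain M A \<alpha> z v b) \<subseteq> curve_darts M z \<times> carrier A"
proof
  fix e assume "e \<in> curve_darts D (lifted_chain M A \<alpha> z v b)"
  then obtain e' where e': "e' \<in> curve_darts M z \<times> carrier A" "edge D e = edge D e'"
    unfolding curve_darts_lifted_chain by blast
  then have "e = e' \<or> e = opp D e'" by (auto simp: edge_def doubleton_eq_iff)
  then show "e \<in> curve_darts M z \<times> carrier A" using e'(1) derived_curve_closed(2) by blast
qed

text \<open>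
  Walks in the cycle lift with any prescribed final layer, so that every point over the cycle lies on the
  component through some lift of \<open>v\<close>.
\<close>

lemma lift_reaches:
  assumes conn: "Digraph_Component.connected (chain_graph M z)"
    and v: "v \<in> verts (chain_graph M z)" and u: "u \<in> verts (chain_graph M z)"
    and c: "c \<in> carrier A"
  shows "\<exists>b\<in>carrier A. (v, b) \<rightarrow>\<^sup>*\<^bsub>graph_preimage M A \<alpha> (chain_graph M z)\<^esub> (u, c)"
proof -
  let ?C = "chain_graph M z" and ?Pre = "graph_preimage M A \<alpha> (chain_graph M z)"
  have "(v, u) \<in> rtrancl_on (verts ?C) ((arcs_ends ?C)\<^sup>s)"
    using conn v u unfolding connected_conv by blast
  then have "\<forall>c\<in>carrier A. \<exists>b\<in>carrier A. (v, b) \<rightarrow>\<^sup>*\<^bsub>?Pre\<^esub> (u, c)"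
  proof (induction rule: rtrancl_on_induct)
    case base
    show ?case
    proof
      fix c assume "c \<in> carrier A"
      then show "\<exists>b\<in>carrier A. (v, b) \<rightarrow>\<^sup>*\<^bsub>?Pre\<^esub> (v, c)"
        using v unfolding reachable_def
        by (intro bexI[of _ c] rtrancl_on_refl) (simp_all add: preimage_simps chain_graph_simps)
    qed
  next
    case (step u w)
    obtain d where d: "d \<in> curve_darts M z" "tail (skel M) d = u" "head (skel M) d = w"
    proof -
      have "(u, w) \<in> arcs_ends ?C \<or> (w, u) \<in> arcs_ends ?C"
        using step.hyps by (auto simp: symcl_def)
      then obtain d where d: "d \<in> curve_darts M z"
        "tail (skel M) d = u \<and> head (skel M) d = w \<or> tail (skel M) d = w \<and> head (skel M) d = u"
        by (auto simp: arcs_ends_conv chain_graph_simps)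
      have "d \<in> arcs (skel M)" using d curve_darts_closed by blast
      then have "tail (skel M) (opp M d) = head (skel M) d" "head (skel M) (opp M d) = tail (skel M) d"
        by auto
      then show ?thesis using that[of d] that[of "opp M d"] d curve_darts_closed(2) by auto
    qed
    have arc: "d \<in> arcs (skel M)" using d curve_darts_closed by blast
    show ?case
    proof
      fix c assume c: "c \<in> carrier A"
      \<comment> \<open>The only layer from which the lift of \<open>d\<close> ends in layer \<open>c\<close>.\<close>
      define k where "k = c \<otimes>\<^bsub>A\<^esub> inv\<^bsub>A\<^esub> \<alpha> d"
      have k: "k \<in> carrier A" "k \<otimes>\<^bsub>A\<^esub> \<alpha> d = c"
        using c voltage_closed[OF arc] by (auto simp: k_def A.m_assoc)
      obtain b where b: "b \<in> carrier A" "(v, b) \<rightarrow>\<^sup>*\<^bsub>?Pre\<^esub> (u, k)" using step.IH k by blast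
      have "((u, k), (w, c)) \<in> arcs_ends ?Pre"
        using d k by (force simp: arcs_ends_conv preimage_simps)
      moreover have "w = tail (skel M) (opp M d)" using arc d by simp
      then have "(w, c) \<in> verts ?Pre"
        using d(1) c curve_darts_closed(2) by (auto simp: preimage_simps)
      ultimately have "(v, b) \<rightarrow>\<^sup>*\<^bsub>?Pre\<^esub> (w, c)"
        using b(2) unfolding reachable_def by (meson rtrancl_on_into_rtrancl_on)
      then show "\<exists>b\<in>carrier A. (v, b) \<rightarrow>\<^sup>*\<^bsub>?Pre\<^esub> (w, c)" using b by blast
    qed
  qed
  then show ?thesis using c by blast
qed

lemma preimage_arc_reaches_head:
  assumes "p \<rightarrow>\<^sup>*\<^bsub>graph_preimage M A \<alpha> (chain_graph M z)\<^esub> tail (skel D) e"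
    and "e \<in> curve_darts M z \<times> carrier A"
  shows "p \<rightarrow>\<^sup>*\<^bsub>graph_preimage M A \<alpha> (chain_graph M z)\<^esub> head (skel D) e"
proof -
  let ?Pre = "graph_preimage M A \<alpha> (chain_graph M z)"
  have "e \<in> arcs (skel D)" using assms(2) derived_curve_closed(1) by blast
  then have "head (skel D) e = tail (skel D) (opp D e)" by (rule D.tail_arev[symmetric])
  moreover obtain d c where "opp D e = (d, c)" "d \<in> curve_darts M z" "c \<in> carrier A"
    using derived_curve_closed(2)[OF assms(2)] by blast
  ultimately have "head (skel D) e \<in> verts ?Pre" by (auto simp: preimage_simps)
  moreover have "(tail (skel D) e, head (skel D) e) \<in> arcs_ends ?Pre"
    using assms(2) by (auto simp: arcs_ends_conv preimage_simps simp del: derived_simps)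
  ultimately show ?thesis
    using assms(1) unfolding reachable_def by (meson rtrancl_on_into_rtrancl_on)
qed

lemma reaches_component:
  assumes "p \<rightarrow>\<^sup>*\<^bsub>graph_preimage M A \<alpha> (chain_graph M z)\<^esub> q"
  shows "Vertex q \<in> component D (cells D) (Vertex p)"
  using assms unfolding reachable_def
proof (induction rule: rtrancl_on_induct)
  case base
  show ?case by (rule component_refl)
next
  case (step q r)
  from step.hyps obtain e where
    e: "e \<in> curve_darts M z \<times> carrier A" "tail (skel D) e = q" "head (skel D) e = r"
    unfolding arcs_ends_conv preimage_simps by blast
  have "e \<in> arcs (skel D)" using e(1) derived_curve_closed(1) by blast
  from D.arc_cells(3)[OF this refl] have "Vertex r \<in> component D (cells D) (Vertex q)"
    unfolding e .
  then show ?case using component_trans step.IH by metis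
qed

lemma vertex_component_coset:
  assumes "Vertex (tail (skel M) (fst x), b) \<in> component D (cells D) (Vertex (tail (skel M) (fst x), a))"
    and "x \<in> flags M" "a \<in> carrier A" "b \<in> carrier A"
  shows "b \<in> a <#\<^bsub>A\<^esub> local_group A (skel M) \<alpha> (tail (skel M) (fst x))"
proof -
  let ?v = "tail (skel M) (fst x)"
  have "Vertex (?v, a) \<in> cells D" using assms by (auto simp: cells_def flags_def)
  then have "(lift_flag a x, lift_flag b x) \<in> flag_conn D {}"
    using assms D.component_cells_flags(2)[of "Vertex (?v, a)" "lift_flag a x" "Vertex (?v, b)" "lift_flag b x"]
    by simp
  moreover define h where "h = inv\<^bsub>A\<^esub> a \<otimes>\<^bsub>A\<^esub> b"
  have h: "h \<in> carrier A" "a \<otimes>\<^bsub>A\<^esub> h = b"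
    using assms by (auto simp: h_def A.m_assoc[symmetric])
  ultimately have "h \<in> return_voltages {} x"
    using flag_conn_translate_iff[of x "\<one>\<^bsub>A\<^esub>" h a x "{}"] assms by (simp add: return_voltages_def)
  then show ?thesis using local_group_conv[OF assms(2) refl] h by (auto simp: l_coset_def)
qed

text \<open>
  The chains indexed by \<open>a A(v)\<close> are enough to cut \<open>S_v^a\<close> along all of the preimage of \<open>G[z]\<close>: a cell of
  the preimage in this component is connected within the preimage to a lift of \<open>v\<close>, and the
  lifts of \<open>v\<close> in \<open>S_v^a\<close> are those in the layers of \<open>a A(v)\<close>.
\<close>

lemma lifted_chains_cut:
  assumes conn: "Digraph_Component.connected (chain_graph M z)"
    and v: "v \<in> verts (chain_graph M z)" and a: "a \<in> carrier A"
  defines "T \<equiv> component D (cells D) (Vertex (v, a))"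
  shows "T - (\<Union>y\<in>lifted_chain M A \<alpha> z v ` (a <#\<^bsub>A\<^esub> local_group A (skel M) \<alpha> v).
      subgraph_cells D (chain_graph D y)) = T - cut_cells D (curve_darts M z \<times> carrier A)"
proof -
  let ?Q = "curve_darts M z \<times> carrier A" and ?B = "a <#\<^bsub>A\<^esub> local_group A (skel M) \<alpha> v"
  let ?cyc = "\<lambda>b. curve_darts D (lifted_chain M A \<alpha> z v b)"
  obtain d0 where d0: "d0 \<in> arcs (skel M)" "tail (skel M) d0 = v"
    using v curve_darts_closed(1) by (auto simp: chain_graph_simps)
  have T: "T \<subseteq> cells D"
    unfolding T_def using d0 a by (intro component_subset) (auto simp: cells_def)
  have mono: "cut_cells D (?cyc b) \<subseteq> cut_cells D ?Q" for b
    unfolding cut_cells_def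
    by (intro Un_mono image_mono curve_darts_lifted_chain_subset)
  have covered: "\<exists>b\<in>?B. c \<in> cut_cells D (?cyc b)" if c: "c \<in> T" "c \<in> cut_cells D ?Q" for c
  proof -
    obtain e where e: "e \<in> ?Q" "c = Vertex (tail (skel D) e) \<or> c = Edge (edge D e)"
      using c(2) unfolding cut_cells_def by blast
    have eD: "e \<in> arcs (skel D)" using e derived_curve_closed(1) by blast
    have "Vertex (tail (skel D) e) \<in> component D (cells D) c"
      using e(2) D.arc_cells(1)[OF eD refl] component_refl by metis
    then have te: "Vertex (tail (skel D) e) \<in> T"
      using c(1) component_trans unfolding T_def by metis
    obtain u k where uk: "tail (skel D) e = (u, k)" "u \<in> verts (chain_graph M z)" "k \<in> carrier A"
      using e(1) by (auto simp: chain_graph_simps)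
    obtain b where b: "b \<in> carrier A"
      "(v, b) \<rightarrow>\<^sup>*\<^bsub>graph_preimage M A \<alpha> (chain_graph M z)\<^esub> tail (skel D) e"
      using lift_reaches[OF conn v uk(2,3)] uk(1) by auto
    have "Vertex (v, b) \<in> T"
      using reaches_component[OF b(2)] te component_trans component_sym unfolding T_def by metis
    then have "b \<in> ?B"
      using vertex_component_coset[of "(d0, True)" b a] d0 a b(1) by (simp add: T_def flags_def)
    moreover have "e \<in> ?cyc b"
      unfolding curve_darts_lifted_chain
      using eD e(1) b(2) preimage_arc_reaches_head[OF b(2) e(1)] by blast
    then have "c \<in> cut_cells D (?cyc b)" using e(2) unfolding cut_cells_def by blast
    ultimately show ?thesis by blast
  qed
  show ?thesis
  proof (rule Set.set_eqI)
    fix c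
    have "(\<exists>b\<in>?B. c \<in> cut_cells D (?cyc b)) \<longleftrightarrow> c \<in> cut_cells D ?Q" if "c \<in> T"
      using covered[OF that] mono by (meson subsetD)
    then show "c \<in> T - (\<Union>y\<in>lifted_chain M A \<alpha> z v ` ?B. subgraph_cells D (chain_graph D y)) \<longleftrightarrow>
        c \<in> T - cut_cells D ?Q"
      unfolding subgraph_cells_chain_graph by (simp only: Diff_iff UN_iff bex_simps) meson
  qed
qed

lemma nonseparating_flag_conn:
  assumes "\<not> separating M (chain_graph M z)" "x \<in> flags M" "y \<in> flags M"
  shows "(x, y) \<in> flag_conn M (curve_darts M z)"
proof -
  let ?U = "cells M - cut_cells M (curve_darts M z)"
  have U: "Face (face M u) \<in> ?U" if "u \<in> flags M" for u
    using Face_in_cells[OF that] by (auto simp: cut_cells_def)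
  have *: "Face (face M y) \<in> component M ?U (Face (face M x))"
    using assms(1) U[OF assms(2)] U[OF assms(3)]
    unfolding separating_def subgraph_cells_chain_graph by blast
  show ?thesis
    by (rule component_flags_conn[OF _ _ U[OF assms(2)] *])
      (simp_all add: self_in_face curve_darts_closed)
qed

end

text \<open>
  The outer vertices of the special claw other than \<open>v\<close> are the two corners at the initial half of the
  first dart, so \<open>w'\<close> is the corner of one of its two flags.
\<close>

lemma first_corner_of_eulerian_walk:
  assumes "eulerian_walk M (chain_graph M z) v W" "v \<in> verts (chain_graph M z)"
    and "w' \<in> verts (special_claw M (hd W)) \<inter> Corner ` corners M"
  obtains s where "hd W \<in> curve_darts M z" "tail (skel M) (hd W) = v" "w' = Corner (corner M (hd W, s))"
proof -
  have "edge M ` curve_darts M z \<noteq> {}" using assms(2) by (auto simp: chain_graph_simps)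
  then have "W \<noteq> []" using assms(1) by (auto simp: eulerian_walk_def chain_graph_simps)
  then obtain d W' where W: "W = d # W'" by (cases W) auto
  then have d: "d \<in> curve_darts M z" "tail (skel M) d = v"
    using assms(1)
    by (auto simp: eulerian_walk_def pre_digraph.awalk_def pre_digraph.cas.simps chain_graph_simps)
  moreover have "\<exists>s. w' = Corner (corner M (d, s))"
    using assms(3) W by (auto simp: special_claw_def Let_def)
  ultimately show ?thesis using that W by auto
qed

text \<open>
  Both groups are computed at the flag \<open>x\<close> of the first dart that lies in the corner \<open>w'\<close>, so that
  the index count of regions applies directly.
\<close>

theorem theorem3p20:
  fixes M :: "('v, 'd) embedding"
    and A :: "('g, 'm) monoid_scheme"
    and \<alpha> :: "'d \<Rightarrow> 'g"
    and P :: "'d set"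
    and z :: "'d chain"
    and W :: "'d list"
    and v :: 'v
    and w' :: "('v, 'd) total_vertex"
    and a :: 'g
  assumes "voltage_graph_embedding M A \<alpha>"
    and "preferred_directions M P"
    and "z \<in> cycle_space M"
    and "is_cycle (chain_graph M z)"
    and "\<not> separating M (chain_graph M z)"
    and "\<forall>u \<in> verts (graph_preimage M A \<alpha> (chain_graph M z)).
           is_cycle (graph_component (graph_preimage M A \<alpha> (chain_graph M z)) u) \<and>
           orientation_preserving (derived_embedding M A \<alpha>)
             (graph_component (graph_preimage M A \<alpha> (chain_graph M z)) u)"
    and "v \<in> verts (chain_graph M z)"
    and "eulerian_walk M (chain_graph M z) v W"
    and "w' \<in> verts (special_claw M (hd W)) \<inter> Corner ` corners M"
    and "a \<in> carrier A"
  shows "real (card (z_regions (derived_embedding M A \<alpha>) (derived_component M A \<alpha> v a)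
            ((\<lambda>b. lifted_chain M A \<alpha> z v b) ` (a <#\<^bsub>A\<^esub> local_group A (skel M) \<alpha> v))))
         = real (card (local_group A (skel M) \<alpha> v)) / real (card (noncrossing_group M A \<alpha> P w' z))"
proof -
  interpret voltage_graph_embedding M A \<alpha> by (rule assms(1))
  let ?Q = "curve_darts M z"
  obtain s where hd: "hd W \<in> ?Q" "tail (skel M) (hd W) = v" "w' = Corner (corner M (hd W, s))"
    using first_corner_of_eulerian_walk[OF assms(8,7,9)] .
  define x where "x = (hd W, s)"
  have x: "x \<in> flags M" "tail (skel M) (fst x) = v"
    using hd curve_darts_closed(1) by (auto simp: x_def flags_def)
  have conn: "Digraph_Component.connected (chain_graph M z)" using assms(4) by (simp add: is_cycle_def)
  have c0: "Vertex (v, a) \<in> cells D" "lift_flag a x \<in> cell_flags D (Vertex (v, a))"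
    using x assms(10) by (force simp: cells_def flags_def, simp)
  have regions: "z_regions D (derived_component M A \<alpha> v a)
      (lifted_chain M A \<alpha> z v ` (a <#\<^bsub>A\<^esub> local_group A (skel M) \<alpha> v)) =
      region_of D (?Q \<times> carrier A) ` {Y. (lift_flag a x, Y) \<in> flag_conn D {}}"
    (is "?R = _")
    unfolding derived_component_def
    by (rule D.z_regions_conv[OF _ _ c0 lifted_chains_cut[OF conn assms(7,10)]])
      (rule derived_curve_closed, assumption?)+
  have "card ?R * card (return_voltages ?Q x) = card (return_voltages {} x)"
    unfolding regions
    by (rule card_regions[OF _ _ _ x(1) assms(10)])
      (simp_all add: curve_darts_closed nonseparating_flag_conn[OF assms(5) x(1)])
  moreover have "return_voltages {} x = local_group A (skel M) \<alpha> v"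
    using local_group_conv[OF x] by simp
  moreover have "return_voltages ?Q x = noncrossing_group M A \<alpha> P w' z"
    using noncrossing_group_conv[OF assms(2) x(1)] hd(3) by (simp add: x_def)
  moreover have "\<one>\<^bsub>A\<^esub> \<in> return_voltages ?Q x" "finite (return_voltages ?Q x)"
    using finite_group by (auto simp: return_voltages_def)
  then have "card (return_voltages ?Q x) > 0" by (auto simp: card_gt_0_iff)
  ultimately have "card ?R * card (noncrossing_group M A \<alpha> P w' z) = card (local_group A (skel M) \<alpha> v)"
    "card (noncrossing_group M A \<alpha> P w' z) > 0" by auto
  then show ?thesis by (simp add: field_simps flip: of_nat_mult)
qed

end
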